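(* Suppose $\mathcal W_n$ is a sequence of integrable graphexes with uniformly bounded $\|\cdot\|_1$-norms that converges to a graphex $\mathcal W$ in the weak kernel metric $\delta_\diamond$. Then $$\|\mathcal W\|_1\le\liminf_{n\to\infty}\|\mathcal W_n\|_1.$$ In particular, $\mathcal W$ is integrable. Furthermore, $$\lim_{n\to\infty}\|\mathcal W_n\|_1=\|\mathcal W\|_1$$ if and only if the sequence $\mathcal W_n$ is uniformly integrable.
   Context: A graphex $\mathcal W=(W,S,I,\mathbf\Omega)$ consists of a $\sigma$-finite measure space $\mathbf\Omega=(\Omega,\mathcal F,\mu)$, a symmetric measurable $W\colon\Omega\times\Omega\to[0,1]$, a measurable $S\colon\Omega\to\mathbb R_+=[0,\infty)$ and $I\in\mathbb R_+$, such that (1) $W(\cdot,x)$ is integrable for almost all $x$, and (2) there is a measurable $\Omega'\subseteq\Omega$ with $\mu(\Omega\setminus\Omega')<\infty$ and $\int_{\Omega'\times\Omega'}W+2\int_{\Omega'}S+2I<\infty$. $\|\mathcal W\|_1=\int W+2\int S+2I$, and $\mathcal W$ is integrable if $\|\mathcal W\|_1<\infty$. The marginal is $D_{\mathcal W}(x)=\int_\Omega W(x,y)\,d\mu(y)+S(x)$. A set $\mathcal S$ of graphexes is uniformly integrable if $\sup_{\mathcal W\in\mathcal S}\|\mathcal W\|_1<\infty$ and for every $\varepsilon>0$ there is a $D$ such that $\|D_{\mathcal W}1_{D_{\mathcal W}>D}\|_1<\varepsilon$ for all $\mathcal W\in\mathcal S$. $\mathcal W$ is in $L^1\cap L^2$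 if both $W$ and $D_{\mathcal W}$ are in $L^1\cap L^2$. Put $\rho(\mathcal W)=\int W+2\int S+2I$. Kernel norm: $\|U\|_{2\to2}=\sup\{\int f(x)U(x,y)g(y)\,d\mu(x)\,d\mu(y):\|f\|_2=\|g\|_2=1\}$. For graphexes in $L^1\cap L^2$ on the same measure space, $$d_{2\to2}(\mathcal W_1,\mathcal W_2)=\max\Big(\|W_1-W_2\|_{2\to2},\ \sqrt{\|D_{\mathcal W_1}-D_{\mathcal W_2}\|_2},\ \sqrt[3]{|\rho(\mathcal W_1)-\rho(\mathcal W_2)|}\Big).$$ A coupling of $\mu_1,\mu_2$ is a measure on $(\Omega_1\times\Omega_2,\mathcal F_1\times\mathcal F_2)$ with marginals $\mu_1,\mu_2$. For $\mu_1(\Omega_1)=\mu_2(\Omega_2)$, $\widetilde\delta_{2\to2}(\mathcal W_1,\mathcal W_2)=\inf_\mu d_{2\to2}(\mathcal W_1^{\pi_1,\mu},\mathcal W_2^{\pi_2,\mu})$ over all couplings $\mu$, where $\pi_i\colon\Omega_1\times\Omega_2\to\Omega_i$ is the projection and $\mathcal W_i^{\pi_i,\mu}=(W_i(\pi_i(\cdot),\pi_i(\cdot)),S_i\circ\pi_i,I_i)$ over $(\Omega_1\times\Omega_2,\mathcal F_1\times\mathcal F_2,\mu)$. A trivial extension of $\mathcal W$ is obtained by enlarging the $\sigma$-finite measure space $\Omega$ to a $\sigma$-finite $\Omega'\supseteq\Omega$ (with $\Omega$ measurable in $\Omega'$, $\sigma$-algebra and measure restricting to those of $\Omega$), extending $W$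 by $0$ off $\Omega\times\Omega$ and $S$ by $0$ off $\Omega$, and keeping $I$. Then $\delta_{2\to2}(\mathcal W_1,\mathcal W_2)=\widetilde\delta_{2\to2}(\mathcal W_1',\mathcal W_2')$ where $\mathcal W_i'$ are trivial extensions of $\mathcal W_i$ to spaces of infinite total mass (the value does not depend on the choice of these extensions). For measures on the same measurable space and $r\ge0$, $\mu-r\le\mu'\le\mu$ means $\mu(B)-r\le\mu'(B)\le\mu(B)$ for all measurable $B$. For graphexes $\mathcal W_i$ over $(\Omega_i,\mathcal F_i,\mu_i)$, the weak kernel distance $\delta_\diamond(\mathcal W_1,\mathcal W_2)$ is the infimum of all real $c$ for which there exist measures $\widetilde\mu_i$ on $(\Omega_i,\mathcal F_i)$ such that the graphexes $\widetilde{\mathcal W}_i$ obtained from $\mathcal W_i$ by replacing $\mu_i$ by $\widetilde\mu_i$ are in $L^1\cap L^2$, $\mu_i-c^2\le\widetilde\mu_i\le\mu_i$ for $i=1,2$, and $\delta_{2\to2}(\widetilde{\mathcal W}_1,\widetilde{\mathcal W}_2)\le c$. *)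

theory Defs
  imports "HOL-Analysis.Analysis"
begin

section \<open>Graphexes\<close>

text \<open>The underlying set of a graphex is the space of its measure, not the whole type, so the members
  of a sequence of type \<open>nat \<Rightarrow> 'a graphex\<close> may live on different measure spaces.\<close>

record 'a graphex =
  base :: "'a measure"
  kern :: "'a \<Rightarrow> 'a \<Rightarrow> real"
  star :: "'a \<Rightarrow> real"
  isol :: real

definition is_graphex :: "'a graphex \<Rightarrow> bool" where
  "is_graphex G \<longleftrightarrow> (let M = base G; W = kern G; S = star G; I = isol G in
     sigma_finite_measure M \<and>
     (\<lambda>(x, y). W x y) \<in> borel_measurable (M \<Otimes>\<^sub>M M) \<and>
     (\<forall>x\<in>space M. \<forall>y\<in>space M. W x y = W y x \<and> 0 \<le> W x y \<and> W x y \<le> 1) \<and>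
     S \<in> borel_measurable M \<and>
     (\<forall>x\<in>space M. 0 \<le> S x) \<and>
     0 \<le> I \<and>
     (AE x in M. integrable M (\<lambda>y. W y x)) \<and>
     (\<exists>A\<in>sets M. emeasure M (space M - A) < \<infinity> \<and>
        (\<integral>\<^sup>+(x, y)\<in>A \<times> A. ennreal (W x y) \<partial>(M \<Otimes>\<^sub>M M))
          + 2 * (\<integral>\<^sup>+x\<in>A. ennreal (S x) \<partial>M) + 2 * ennreal I < \<infinity>))"

text \<open>All three parts of a graphex are nonnegative, so \<open>graphex_norm1\<close> also represents the
  quantity \<open>\<rho>\<close>; it is finite whenever the graphex is in \<open>L\<^sup>1 \<inter> L\<^sup>2\<close>.\<close>

definition graphex_norm1 :: "'a graphex \<Rightarrow> ennreal" where
  "graphex_norm1 G =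
     (\<integral>\<^sup>+(x, y). ennreal (kern G x y) \<partial>(base G \<Otimes>\<^sub>M base G))
     + 2 * (\<integral>\<^sup>+x. ennreal (star G x) \<partial>base G) + 2 * ennreal (isol G)"

definition graphex_rho :: "'a graphex \<Rightarrow> real" where
  "graphex_rho G = enn2real (graphex_norm1 G)"

definition graphex_integrable :: "'a graphex \<Rightarrow> bool" where
  "graphex_integrable G \<longleftrightarrow> graphex_norm1 G < \<infinity>"

definition marginal :: "'a graphex \<Rightarrow> 'a \<Rightarrow> ennreal" where
  "marginal G x = (\<integral>\<^sup>+y. ennreal (kern G x y) \<partial>base G) + ennreal (star G x)"

definition graphex_uniformly_integrable :: "'a graphex set \<Rightarrow> bool" where
  "graphex_uniformly_integrable \<S> \<longleftrightarrow>
     (SUP G\<in>\<S>. graphex_norm1 G) < \<infinity> \<and>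
     (\<forall>\<epsilon>>0. \<exists>D::real. \<forall>G\<in>\<S>.
        (\<integral>\<^sup>+x. marginal G x * indicator {x. marginal G x > ennreal D} x \<partial>base G)
          < ennreal \<epsilon>)"

definition graphex_L1_L2 :: "'a graphex \<Rightarrow> bool" where
  "graphex_L1_L2 G \<longleftrightarrow> (let M = base G; W = kern G in
     (\<integral>\<^sup>+(x, y). ennreal (W x y) \<partial>(M \<Otimes>\<^sub>M M)) < \<infinity> \<and>
     (\<integral>\<^sup>+(x, y). (ennreal (W x y))\<^sup>2 \<partial>(M \<Otimes>\<^sub>M M)) < \<infinity> \<and>
     (\<integral>\<^sup>+x. marginal G x \<partial>M) < \<infinity> \<and>
     (\<integral>\<^sup>+x. (marginal G x)\<^sup>2 \<partial>M) < \<infinity>)"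


section \<open>The distance on graphexes over a common measure space\<close>

text \<open>This is the \<open>L\<^sup>2\<close> norm for \<open>f\<close> in \<open>L\<^sup>2\<close>. If \<open>f\<^sup>2\<close> is not integrable then the value is \<open>0\<close>, so
  \<open>L2_norm M f = 1\<close> entails square integrability.\<close>

definition L2_norm :: "'a measure \<Rightarrow> ('a \<Rightarrow> real) \<Rightarrow> real" where
  "L2_norm M f = sqrt (\<integral>x. (f x)\<^sup>2 \<partial>M)"

text \<open>Truncation of negative values by \<open>ennreal\<close> does not affect the supremum, since \<open>f\<close> may be
  replaced by \<open>-f\<close>. On a null space the supremum is over the empty set and equals \<open>0\<close>.\<close>

definition kernel_norm :: "'a measure \<Rightarrow> ('a \<Rightarrow> 'a \<Rightarrow> real) \<Rightarrow> ennreal" where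
  "kernel_norm M U =
     Sup {ennreal (\<integral>(x, y). f x * U x y * g y \<partial>(M \<Otimes>\<^sub>M M)) | f g.
            f \<in> borel_measurable M \<and> g \<in> borel_measurable M \<and>
            L2_norm M f = 1 \<and> L2_norm M g = 1}"

text \<open>Meant for \<open>base G\<^sub>1 = base G\<^sub>2\<close> and \<open>G\<^sub>1, G\<^sub>2\<close> in \<open>L\<^sup>1 \<inter> L\<^sup>2\<close>, in which case the marginals are
  finite almost everywhere.\<close>

definition d22 :: "'a graphex \<Rightarrow> 'a graphex \<Rightarrow> ennreal" where
  "d22 G\<^sub>1 G\<^sub>2 = Max {
     kernel_norm (base G\<^sub>1) (\<lambda>x y. kern G\<^sub>1 x y - kern G\<^sub>2 x y),
     ennreal (sqrt (L2_norm (base G\<^sub>1)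
       (\<lambda>x. enn2real (marginal G\<^sub>1 x) - enn2real (marginal G\<^sub>2 x)))),
     ennreal (root 3 \<bar>graphex_rho G\<^sub>1 - graphex_rho G\<^sub>2\<bar>)}"


section \<open>Couplings and trivial extensions\<close>

definition couplings :: "'a measure \<Rightarrow> 'b measure \<Rightarrow> ('a \<times> 'b) measure set" where
  "couplings M\<^sub>1 M\<^sub>2 = {\<nu>. sets \<nu> = sets (M\<^sub>1 \<Otimes>\<^sub>M M\<^sub>2) \<and>
     distr \<nu> M\<^sub>1 fst = M\<^sub>1 \<and> distr \<nu> M\<^sub>2 snd = M\<^sub>2}"

definition pullback :: "('c \<Rightarrow> 'a) \<Rightarrow> 'c measure \<Rightarrow> 'a graphex \<Rightarrow> 'c graphex" where
  "pullback \<pi> \<nu> G = \<lparr>base = \<nu>, kern = (\<lambda>x y. kern G (\<pi> x) (\<pi> y)),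
     star = (\<lambda>x. star G (\<pi> x)), isol = isol G\<rparr>"

definition delta22_tilde :: "'a graphex \<Rightarrow> 'b graphex \<Rightarrow> ennreal" where
  "delta22_tilde G\<^sub>1 G\<^sub>2 =
     (INF \<nu>\<in>couplings (base G\<^sub>1) (base G\<^sub>2). d22 (pullback fst \<nu> G\<^sub>1) (pullback snd \<nu> G\<^sub>2))"

definition sum_measure :: "'a measure \<Rightarrow> 'b measure \<Rightarrow> ('a + 'b) measure" where
  "sum_measure M N = measure_of (space M <+> space N) {A <+> B | A B. A \<in> sets M \<and> B \<in> sets N}
     (\<lambda>X. emeasure M (Inl -` X) + emeasure N (Inr -` X))"

text \<open>The distance \<open>\<delta>\<close> below does not depend on the choice of the trivial extensions to spaces of
  infinite mass. We adjoin a disjoint copy of the real line with Lebesgue measure, \<open>\<Omega>\<close> being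
  identified with its image under \<open>Inl\<close>.\<close>

definition trivial_extension :: "'a graphex \<Rightarrow> ('a + real) graphex" where
  "trivial_extension G = \<lparr>base = sum_measure (base G) lborel,
     kern = (\<lambda>p q. case (p, q) of (Inl x, Inl y) \<Rightarrow> kern G x y | _ \<Rightarrow> 0),
     star = (\<lambda>p. case p of Inl x \<Rightarrow> star G x | Inr _ \<Rightarrow> 0),
     isol = isol G\<rparr>"

definition delta22 :: "'a graphex \<Rightarrow> 'b graphex \<Rightarrow> ennreal" where
  "delta22 G\<^sub>1 G\<^sub>2 = delta22_tilde (trivial_extension G\<^sub>1) (trivial_extension G\<^sub>2)"

lemma sets_sum_measure_eq:
  "sets (sum_measure M N) = {A <+> B | A B. A \<in> sets M \<and> B \<in> sets N}"
  and space_sum_measure: "space (sum_measure M N) = space M <+> space N"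
proof -
  let ?\<Omega> = "space M <+> space N" and ?F = "{A <+> B | A B. A \<in> sets M \<and> B \<in> sets N}"
  have sub: "?F \<subseteq> Pow ?\<Omega>"
    by (auto dest: sets.sets_into_space[THEN subsetD])
  have "sigma_algebra ?\<Omega> ?F"
    unfolding sigma_algebra_iff2
  proof (intro conjI ballI allI impI)
    show "?F \<subseteq> Pow ?\<Omega>" by (rule sub)
    have "{} = ({} :: 'a set) <+> ({} :: 'b set)" by auto
    then show "{} \<in> ?F" by blast
  next
    fix X assume "X \<in> ?F"
    then obtain A B where X: "X = A <+> B" and A: "A \<in> sets M" and B: "B \<in> sets N" by auto
    have "?\<Omega> - X = (space M - A) <+> (space N - B)" unfolding X by auto
    with A B show "?\<Omega> - X \<in> ?F" by blast
  next
    fix X :: "nat \<Rightarrow> ('a + 'b) set" assume "range X \<subseteq> ?F"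
    then have "\<forall>i. \<exists>A B. X i = A <+> B \<and> A \<in> sets M \<and> B \<in> sets N" by blast
    then obtain A B where X: "\<And>i. X i = A i <+> B i"
      and A: "\<And>i. A i \<in> sets M" and B: "\<And>i. B i \<in> sets N" by metis
    have "(\<Union>i. X i) = (\<Union>i. A i) <+> (\<Union>i. B i)" unfolding X by auto
    moreover have "(\<Union>i. A i) \<in> sets M" "(\<Union>i. B i) \<in> sets N" using A B by auto
    ultimately show "(\<Union>i. X i) \<in> ?F" by blast
  qed
  then show "sets (sum_measure M N) = ?F"
    unfolding sum_measure_def by (rule sigma_algebra.sets_measure_of_eq)
  show "space (sum_measure M N) = ?\<Omega>"
    unfolding sum_measure_def using sub by (simp add: space_measure_of)
qed

lemma vimage_Inl_Plus: "Inl -` (A <+> B) = A" and vimage_Inr_Plus: "Inr -` (A <+> B) = B"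
  by auto

lemma emeasure_sum_measure:
  assumes A: "A \<in> sets M" and B: "B \<in> sets N"
  shows "emeasure (sum_measure M N) (A <+> B) = emeasure M A + emeasure N B"
proof -
  let ?\<mu> = "\<lambda>X. emeasure M (Inl -` X) + emeasure N (Inr -` X)"
  have "emeasure (sum_measure M N) (A <+> B) = ?\<mu> (A <+> B)"
  proof (rule emeasure_measure_of[OF sum_measure_def])
    show "{A <+> B |A B. A \<in> sets M \<and> B \<in> sets N} \<subseteq> Pow (space M <+> space N)"
      by (auto dest: sets.sets_into_space[THEN subsetD])
    show "A <+> B \<in> sets (sum_measure M N)"
      using A B by (auto simp: sets_sum_measure_eq)
    show "positive (sets (sum_measure M N)) ?\<mu>"
      by (simp add: positive_def)
    show "countably_additive (sets (sum_measure M N)) ?\<mu>"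
      unfolding countably_additive_def
    proof (intro allI impI)
      fix X :: "nat \<Rightarrow> ('a + 'b) set"
      assume X: "range X \<subseteq> sets (sum_measure M N)" and disj: "disjoint_family X"
      have "Inl -` X i \<in> sets M \<and> Inr -` X i \<in> sets N" for i
      proof -
        have "X i \<in> sets (sum_measure M N)" using X by blast
        then obtain A B where "X i = A <+> B" "A \<in> sets M" "B \<in> sets N"
          unfolding sets_sum_measure_eq by blast
        then show ?thesis by (simp only: vimage_Inl_Plus vimage_Inr_Plus)
      qed
      then have L: "range (\<lambda>i. Inl -` X i) \<subseteq> sets M" and R: "range (\<lambda>i. Inr -` X i) \<subseteq> sets N"
        by blast+
      have dL: "disjoint_family (\<lambda>i. Inl -` X i)" and dR: "disjoint_family (\<lambda>i. Inr -` X i)"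
        using disj by (auto simp: disjoint_family_on_def)
      show "(\<Sum>i. ?\<mu> (X i)) = ?\<mu> (\<Union>i. X i)"
        using suminf_emeasure[OF L dL] suminf_emeasure[OF R dR]
        by (simp add: vimage_UN suminf_add[symmetric])
    qed
  qed
  then show ?thesis by (simp only: vimage_Inl_Plus vimage_Inr_Plus)
qed

lemma sigma_finite_sum_measure:
  assumes "sigma_finite_measure M" "sigma_finite_measure N"
  shows "sigma_finite_measure (sum_measure M N)"
proof -
  obtain A :: "nat \<Rightarrow> _" where A: "range A \<subseteq> sets M" "(\<Union>i. A i) = space M"
    "\<And>i. emeasure M (A i) \<noteq> \<infinity>" "incseq A"
    using sigma_finite_measure.sigma_finite_incseq[OF assms(1)] by metis
  obtain B :: "nat \<Rightarrow> _" where B: "range B \<subseteq> sets N" "(\<Union>i. B i) = space N"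
    "\<And>i. emeasure N (B i) \<noteq> \<infinity>" "incseq B"
    using sigma_finite_measure.sigma_finite_incseq[OF assms(2)] by metis
  let ?C = "range (\<lambda>i. A i <+> B i)"
  show ?thesis
  proof
    have AB: "A i \<in> sets M" "B i \<in> sets N" for i using A(1) B(1) by auto
    have "countable ?C" by simp
    moreover have "?C \<subseteq> sets (sum_measure M N)"
      using AB by (auto simp: sets_sum_measure_eq)
    moreover have "\<Union> ?C = space (sum_measure M N)"
    proof -
      have "\<Union> ?C = (\<Union>i. A i) <+> (\<Union>i. B i)" by auto
      then show ?thesis by (simp add: space_sum_measure A(2) B(2))
    qed
    moreover have "\<forall>c\<in>?C. emeasure (sum_measure M N) c \<noteq> \<infinity>"
      using A(3) B(3) by (auto simp: emeasure_sum_measure AB)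
    ultimately show "\<exists>C. countable C \<and> C \<subseteq> sets (sum_measure M N) \<and>
        \<Union> C = space (sum_measure M N) \<and> (\<forall>c\<in>C. emeasure (sum_measure M N) c \<noteq> \<infinity>)"
      by blast
  qed
qed

lemma emeasure_base_trivial_extension:
  "emeasure (base (trivial_extension G)) (space (base (trivial_extension G))) = \<infinity>"
  by (simp add: trivial_extension_def space_sum_measure emeasure_sum_measure)


section \<open>The weak kernel distance\<close>

text \<open>\<open>\<mu> - r \<le> \<mu>' \<le> \<mu>\<close>\<close>

definition measure_within :: "'a measure \<Rightarrow> real \<Rightarrow> 'a measure \<Rightarrow> bool" where
  "measure_within M r M' \<longleftrightarrow> sets M' = sets M \<and>
     (\<forall>B\<in>sets M. emeasure M B \<le> emeasure M' B + ennreal r \<and> emeasure M' B \<le> emeasure M B)"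

text \<open>The constraint \<open>0 \<le> c\<close> is implied by \<open>\<delta> \<le> c\<close> over the reals, but not by the inequality in
  \<open>ennreal\<close>, as \<open>ennreal\<close> maps negative numbers to \<open>0\<close>. That \<open>G\<^sub>i\<lparr>base := M\<^sub>i\<rparr>\<close> is again a graphex
  follows from \<open>M\<^sub>i \<le> base G\<^sub>i\<close>.\<close>

definition weak_kernel_dist :: "'a graphex \<Rightarrow> 'b graphex \<Rightarrow> ennreal" where
  "weak_kernel_dist G\<^sub>1 G\<^sub>2 = Inf {ennreal c | c. 0 \<le> c \<and>
     (\<exists>M\<^sub>1 M\<^sub>2. measure_within (base G\<^sub>1) (c\<^sup>2) M\<^sub>1 \<and> measure_within (base G\<^sub>2) (c\<^sup>2) M\<^sub>2 \<and>
        graphex_L1_L2 (G\<^sub>1\<lparr>base := M\<^sub>1\<rparr>) \<and> graphex_L1_L2 (G\<^sub>2\<lparr>base := M\<^sub>2\<rparr>) \<and>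
        delta22 (G\<^sub>1\<lparr>base := M\<^sub>1\<rparr>) (G\<^sub>2\<lparr>base := M\<^sub>2\<rparr>) \<le> ennreal c)}"

end

(*
Only two consequences of closeness in the weak kernel distance are needed: closeness of rho and
L^2-closeness of the marginals under a coupling. A measure M' with M - r <= M' <= M has a
density g <= 1 with respect to M such that 1 - g has integral at most r.

Semicontinuity: the truncated marginals of H integrate over M' to nearly the same value as over M,
and the norm of H over the smaller measure is at most the norm of G n up to a small error.

Uniform integrability implies convergence: the norm of G lost when passing to the smaller measure
is at most twice the integral of D (1 - g), where D is the marginal of G. This is small if the
marginals are uniformly integrable.

Convergence implies uniform integrability: the norms lost by G n tend to 0, so it suffices to bound
the integral of the marginal of G n over B = {D > K} for the smaller measure. By Markov's inequality
B has small mass, and the coupling replaces the marginal of G n by that of H, which is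
integrable, at the cost of the L^2 distance and the mass of B.
*)

theory Submission
  imports Defs
begin


section \<open>Pullbacks and trivial extensions\<close>

text \<open>The obstacle is that the mass removed from a measure is small but may sit exactly where
  the marginal is large, and that \<open>H\<close> is not known to be integrable at the outset. For
  semicontinuity the outer integrand of the norm of \<open>H\<close> is therefore cut at a level
  \<open>k\<close> and restricted to a set \<open>A\<close> of finite mass. Restoring the measure
  then costs at most \<open>r * k\<close> in the outer variable and, as the kernel is at most 1,
  \<open>r\<close> times the mass of \<open>A\<close> in the inner one. With \<open>k\<close> and
  \<open>A\<close> fixed this tends to 0, and monotone convergence removes the cut afterwards. For
  the last implication nothing is known in advance about the tails of the \<open>G n\<close>, so
  their loss is controlled by comparing norms: the norm of \<open>G n\<close> is eventually at most
  slightly above that of \<open>H\<close>, \<open>H\<close> loses little, and over the smaller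
  measures the two norms nearly agree. The powers of \<open>e\<close> come from the distance: masses
  change by at most \<open>e ^ 2\<close>, \<open>graphex_rho\<close> by \<open>e ^ 3\<close>, and
  the squared L^2 distance of the marginals is at most \<open>e ^ 4\<close>.\<close>

definition measurable_graphex :: "'a graphex \<Rightarrow> bool" where
  "measurable_graphex G \<longleftrightarrow> sigma_finite_measure (base G) \<and>
     (\<lambda>(x, y). kern G x y) \<in> borel_measurable (base G \<Otimes>\<^sub>M base G) \<and>
     star G \<in> borel_measurable (base G)"

text \<open>Fubini needs sigma-finiteness and joint measurability, and both pass to pullbacks,
  trivial extensions and smaller measures. Symmetry of the kernel and its bound 1 enter later as
  separate hypotheses.\<close>

lemma is_graphex_measurable: "is_graphex G \<Longrightarrow> measurable_graphex G"
  by (simp add: is_graphex_def measurable_graphex_def Let_def)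

lemma sigma_finite_base: "measurable_graphex G \<Longrightarrow> sigma_finite_measure (base G)"
  by (simp add: measurable_graphex_def)

lemma borel_measurable_kern_section:
  assumes "measurable_graphex G" "x \<in> space (base G)"
  shows "kern G x \<in> borel_measurable (base G)"
proof -
  have "(\<lambda>(x, y). kern G x y) \<in> borel_measurable (base G \<Otimes>\<^sub>M base G)"
    using assms(1) by (simp add: measurable_graphex_def)
  from measurable_compose[OF measurable_Pair1'[OF assms(2)] this] show ?thesis by simp
qed

lemma borel_measurable_degree:
  assumes "measurable_graphex G"
  shows "(\<lambda>x. \<integral>\<^sup>+y. ennreal (kern G x y) \<partial>base G) \<in> borel_measurable (base G)"
proof -
  interpret sigma_finite_measure "base G" using assms by (simp add: measurable_graphex_def)
  have "(\<lambda>(x, y). kern G x y) \<in> borel_measurable (base G \<Otimes>\<^sub>M base G)"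
    using assms by (simp add: measurable_graphex_def)
  from measurable_compose[OF this measurable_ennreal]
  have "(\<lambda>(x, y). ennreal (kern G x y)) \<in> borel_measurable (base G \<Otimes>\<^sub>M base G)"
    by (simp add: case_prod_beta)
  then show ?thesis by (rule borel_measurable_nn_integral)
qed

lemma borel_measurable_star:
  "measurable_graphex G \<Longrightarrow> (\<lambda>x. ennreal (star G x)) \<in> borel_measurable (base G)"
  unfolding measurable_graphex_def by (intro measurable_compose[OF _ measurable_ennreal]) blast

lemma borel_measurable_marginal:
  "measurable_graphex G \<Longrightarrow> marginal G \<in> borel_measurable (base G)"
  unfolding marginal_def[abs_def]
  by (intro borel_measurable_add borel_measurable_degree borel_measurable_star)

text \<open>The iterated form allows a change of measure to be carried out one variable at a
  time.\<close>

lemma graphex_norm1_iterated: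
  assumes "measurable_graphex G"
  shows "graphex_norm1 G = (\<integral>\<^sup>+x. (\<integral>\<^sup>+y. ennreal (kern G x y) \<partial>base G) \<partial>base G)
    + 2 * (\<integral>\<^sup>+x. ennreal (star G x) \<partial>base G) + 2 * ennreal (isol G)"
proof -
  interpret sigma_finite_measure "base G" using assms by (simp add: measurable_graphex_def)
  have "(\<lambda>(x, y). kern G x y) \<in> borel_measurable (base G \<Otimes>\<^sub>M base G)"
    using assms by (simp add: measurable_graphex_def)
  from measurable_compose[OF this measurable_ennreal]
  have "(\<lambda>(x, y). ennreal (kern G x y)) \<in> borel_measurable (base G \<Otimes>\<^sub>M base G)"
    by (simp add: case_prod_beta)
  then show ?thesis
    unfolding graphex_norm1_def by (subst nn_integral_fst[symmetric]) auto
qed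

lemma nn_integral_marginal:
  assumes "measurable_graphex G"
  shows "(\<integral>\<^sup>+x. marginal G x \<partial>base G) = (\<integral>\<^sup>+x. (\<integral>\<^sup>+y. ennreal (kern G x y) \<partial>base G) \<partial>base G)
    + (\<integral>\<^sup>+x. ennreal (star G x) \<partial>base G)"
  unfolding marginal_def
  by (intro nn_integral_add borel_measurable_degree borel_measurable_star assms)

lemma graphex_norm1_marginal:
  assumes "measurable_graphex G"
  shows "graphex_norm1 G = (\<integral>\<^sup>+x. marginal G x \<partial>base G)
    + (\<integral>\<^sup>+x. ennreal (star G x) \<partial>base G) + 2 * ennreal (isol G)"
  using graphex_norm1_iterated[OF assms] nn_integral_marginal[OF assms]
  by (simp add: mult_2 add.assoc)

lemma nn_integral_marginal_le_norm1:
  "measurable_graphex G \<Longrightarrow> (\<integral>\<^sup>+x. marginal G x \<partial>base G) \<le> graphex_norm1 G"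
  by (simp add: graphex_norm1_marginal add.assoc)

lemma base_pullback [simp]: "base (pullback \<pi> \<nu> G) = \<nu>"
  and star_pullback [simp]: "star (pullback \<pi> \<nu> G) = (\<lambda>x. star G (\<pi> x))"
  and kern_pullback [simp]: "kern (pullback \<pi> \<nu> G) = (\<lambda>x y. kern G (\<pi> x) (\<pi> y))"
  and isol_pullback [simp]: "isol (pullback \<pi> \<nu> G) = isol G"
  by (simp_all add: pullback_def)

section \<open>Pullbacks along measure-preserving maps\<close>

context
  fixes \<pi> :: "'c \<Rightarrow> 'a" and \<nu> :: "'c measure" and G :: "'a graphex"
  assumes G: "measurable_graphex G"
    and pi [measurable]: "\<pi> \<in> measurable \<nu> (base G)"
    and distr: "distr \<nu> (base G) \<pi> = base G"
begin

lemma nn_integral_pullback: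
  assumes "f \<in> borel_measurable (base G)"
  shows "(\<integral>\<^sup>+z. f (\<pi> z) \<partial>\<nu>) = (\<integral>\<^sup>+x. f x \<partial>base G)"
  using nn_integral_distr[OF pi, of f] assms by (simp add: distr)

lemma measurable_graphex_pullback: "measurable_graphex (pullback \<pi> \<nu> G)"
proof -
  have [measurable]: "(\<lambda>(x, y). kern G x y) \<in> borel_measurable (base G \<Otimes>\<^sub>M base G)"
    "star G \<in> borel_measurable (base G)"
    using G by (auto simp: measurable_graphex_def)
  have "(\<lambda>p. (\<lambda>(x, y). kern G x y) (\<pi> (fst p), \<pi> (snd p))) \<in> borel_measurable (\<nu> \<Otimes>\<^sub>M \<nu>)"
    by measurable
  \<comment> \<open>A countable cover of \<open>base G\<close> by sets of finite mass pulls back to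
    such a cover for \<open>\<nu>\<close>.\<close>
  moreover have "sigma_finite_measure \<nu>"
    using G by (intro sigma_finite_measure_distr[OF _ pi]) (simp add: distr measurable_graphex_def)
  ultimately show ?thesis
    unfolding measurable_graphex_def by (simp add: case_prod_beta)
qed

lemma degree_pullback:
  assumes "z \<in> space \<nu>"
  shows "(\<integral>\<^sup>+w. ennreal (kern G (\<pi> z) (\<pi> w)) \<partial>\<nu>) = (\<integral>\<^sup>+y. ennreal (kern G (\<pi> z) y) \<partial>base G)"
  using borel_measurable_kern_section[OF G measurable_space[OF pi assms]]
  by (intro nn_integral_pullback) auto

lemma marginal_pullback: "z \<in> space \<nu> \<Longrightarrow> marginal (pullback \<pi> \<nu> G) z = marginal G (\<pi> z)"
  by (simp add: marginal_def degree_pullback)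

lemma graphex_norm1_pullback: "graphex_norm1 (pullback \<pi> \<nu> G) = graphex_norm1 G"
proof -
  have "(\<integral>\<^sup>+z. (\<integral>\<^sup>+w. ennreal (kern G (\<pi> z) (\<pi> w)) \<partial>\<nu>) \<partial>\<nu>)
      = (\<integral>\<^sup>+z. (\<integral>\<^sup>+y. ennreal (kern G (\<pi> z) y) \<partial>base G) \<partial>\<nu>)"
    by (intro nn_integral_cong degree_pullback)
  also have "\<dots> = (\<integral>\<^sup>+x. (\<integral>\<^sup>+y. ennreal (kern G x y) \<partial>base G) \<partial>base G)"
    by (rule nn_integral_pullback) (rule borel_measurable_degree[OF G])
  finally have "(\<integral>\<^sup>+z. (\<integral>\<^sup>+w. ennreal (kern G (\<pi> z) (\<pi> w)) \<partial>\<nu>) \<partial>\<nu>)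
      = (\<integral>\<^sup>+x. (\<integral>\<^sup>+y. ennreal (kern G x y) \<partial>base G) \<partial>base G)" .
  moreover have "(\<integral>\<^sup>+z. ennreal (star G (\<pi> z)) \<partial>\<nu>) = (\<integral>\<^sup>+x. ennreal (star G x) \<partial>base G)"
    by (intro nn_integral_pullback borel_measurable_star G)
  ultimately show ?thesis
    by (simp add: graphex_norm1_iterated[OF measurable_graphex_pullback] graphex_norm1_iterated[OF G])
qed

end

section \<open>Integration over disjoint sums, and trivial extensions\<close>

lemma measurable_Inl_sum_measure [measurable]: "Inl \<in> measurable M (sum_measure M N)"
  and measurable_Inr_sum_measure [measurable]: "Inr \<in> measurable N (sum_measure M N)"
  by (auto intro!: measurableI simp: space_sum_measure sets_sum_measure_eq)
    (simp_all only: vimage_Inl_Plus vimage_Inr_Plus sets.Int_space_eq2)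

text \<open>Induction on nonnegative measurable functions: both sides agree on indicators of sets
  \<open>A <+> B\<close> and respect scaling, sums and increasing limits.\<close>

lemma nn_integral_sum_measure:
  assumes "f \<in> borel_measurable (sum_measure M N)"
  shows "(\<integral>\<^sup>+p. f p \<partial>sum_measure M N) = (\<integral>\<^sup>+x. f (Inl x) \<partial>M) + (\<integral>\<^sup>+y. f (Inr y) \<partial>N)"
  using assms
proof induction
  case (cong f g)
  have "(\<integral>\<^sup>+p. f p \<partial>sum_measure M N) = (\<integral>\<^sup>+p. g p \<partial>sum_measure M N)"
    by (intro nn_integral_cong) (simp add: cong)
  moreover have "(\<integral>\<^sup>+x. f (Inl x) \<partial>M) = (\<integral>\<^sup>+x. g (Inl x) \<partial>M)"
      "(\<integral>\<^sup>+y. f (Inr y) \<partial>N) = (\<integral>\<^sup>+y. g (Inr y) \<partial>N)"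
    by (auto intro!: nn_integral_cong cong simp: space_sum_measure)
  ultimately show ?case using cong by simp
next
  case (set X)
  then obtain A B where X: "X = A <+> B" and AB: "A \<in> sets M" "B \<in> sets N"
    unfolding sets_sum_measure_eq by blast
  have "indicator X (Inl x) = (indicator A x :: ennreal)"
    and "indicator X (Inr y) = (indicator B y :: ennreal)" for x y
    by (auto simp: X indicator_def)
  moreover have "(\<integral>\<^sup>+p. indicator X p \<partial>sum_measure M N) = emeasure M A + emeasure N B"
    using set by (simp add: X emeasure_sum_measure AB)
  ultimately show ?case using AB by simp
next
  case (mult u c)
  then show ?case
    by (simp add: nn_integral_cmult distrib_left)
next
  case (add u v)
  then show ?case
    by (simp add: nn_integral_add algebra_simps)
next
  case (seq U)
  have U: "U m p \<le> U n p" if "m \<le> n" for m n p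
    using seq(3) that by (auto dest: incseqD simp: le_fun_def)
  have inc: "incseq (\<lambda>i x. U i (Inl x))" "incseq (\<lambda>i x. U i (Inr x))"
    by (auto simp: mono_def le_fun_def U)
  have "(\<integral>\<^sup>+p. (SUP i. U i) p \<partial>sum_measure M N) = (SUP i. \<integral>\<^sup>+p. U i p \<partial>sum_measure M N)"
    using seq(1,3) by (simp add: nn_integral_monotone_convergence_SUP[symmetric] image_comp)
  also have "\<dots> = (SUP i. (\<integral>\<^sup>+x. U i (Inl x) \<partial>M) + (\<integral>\<^sup>+y. U i (Inr y) \<partial>N))"
    using seq(5) by simp
  also have "\<dots> = (SUP i. \<integral>\<^sup>+x. U i (Inl x) \<partial>M) + (SUP i. \<integral>\<^sup>+y. U i (Inr y) \<partial>N)"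
    using inc by (intro ennreal_SUP_add) (auto simp: mono_def le_fun_def intro!: nn_integral_mono)
  also have "\<dots> = (\<integral>\<^sup>+x. (SUP i. U i) (Inl x) \<partial>M) + (\<integral>\<^sup>+y. (SUP i. U i) (Inr y) \<partial>N)"
    using seq(1) inc by (simp add: nn_integral_monotone_convergence_SUP[symmetric] image_comp)
  finally show ?case .
qed

lemma measurable_case_sum_measure:
  assumes "f \<in> measurable M K" "g \<in> measurable N K"
  shows "case_sum f g \<in> measurable (sum_measure M N) K"
proof (rule measurableI)
  fix A assume A: "A \<in> sets K"
  have "case_sum f g -` A \<inter> space (sum_measure M N)
      = (f -` A \<inter> space M) <+> (g -` A \<inter> space N)"
    by (auto simp: space_sum_measure)
  then show "case_sum f g -` A \<inter> space (sum_measure M N) \<in> sets (sum_measure M N)"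
    using measurable_sets[OF assms(1) A] measurable_sets[OF assms(2) A]
    unfolding sets_sum_measure_eq by blast
qed (use assms in \<open>auto simp: space_sum_measure dest: measurable_space\<close>)

lemma base_trivial_extension: "base (trivial_extension G) = sum_measure (base G) lborel"
  and star_trivial_extension: "star (trivial_extension G) = case_sum (star G) (\<lambda>_. 0)"
  and isol_trivial_extension: "isol (trivial_extension G) = isol G"
  by (auto simp: trivial_extension_def fun_eq_iff split: sum.splits)

lemma kern_trivial_extension [simp]:
  "kern (trivial_extension G) (Inl x) (Inl y) = kern G x y"
  "kern (trivial_extension G) p (Inr r) = 0"
  "kern (trivial_extension G) (Inr r) p = 0"
  by (auto simp: trivial_extension_def split: sum.splits)

lemma measurable_graphex_trivial_extension:
  assumes "measurable_graphex G"
  shows "measurable_graphex (trivial_extension G)"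
proof -
  let ?M = "sum_measure (base G) (lborel :: real measure)"
  have [measurable]: "star G \<in> borel_measurable (base G)"
    and K: "(\<lambda>(x, y). kern G x y) \<in> borel_measurable (base G \<Otimes>\<^sub>M base G)"
    using assms by (auto simp: measurable_graphex_def)
  have "(\<lambda>p. kern (trivial_extension G) (fst p) (snd p)) \<in> borel_measurable (?M \<Otimes>\<^sub>M ?M)"
  proof (cases "space (base G) = {}")
    \<comment> \<open>An empty base has no point to serve as the default \<open>a\<close> below, but
      then all points are of the form \<open>Inr r\<close> and the kernel vanishes.\<close>
    case True
    have "kern (trivial_extension G) (fst p) (snd p) = 0" if "p \<in> space (?M \<Otimes>\<^sub>M ?M)" for p
      using that True by (auto simp: space_pair_measure space_sum_measure)
    then show ?thesis by (subst measurable_cong[where g="\<lambda>_. 0"]) auto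
  next
    case False
    then obtain a where a: "a \<in> space (base G)" by blast
    \<comment> \<open>The extended kernel becomes a composition of measurable maps: \<open>h\<close>
      sends the adjoined line to the default point \<open>a\<close>, and the factors
      \<open>l\<close> erase the wrong values this creates.\<close>
    define h where "h = case_sum (\<lambda>x. x) (\<lambda>_::real. a)"
    define l where "l = case_sum (\<lambda>_::'a. 1::real) (\<lambda>_::real. 0)"
    have [measurable]: "h \<in> measurable ?M (base G)" "l \<in> borel_measurable ?M"
      unfolding h_def l_def using a by (auto intro!: measurable_case_sum_measure)
    have "(\<lambda>p. (\<lambda>(x, y). kern G x y) (h (fst p), h (snd p)) * l (fst p) * l (snd p))
        \<in> borel_measurable (?M \<Otimes>\<^sub>M ?M)"
      using K by measurable
    also have "(\<lambda>p. (\<lambda>(x, y). kern G x y) (h (fst p), h (snd p)) * l (fst p) * l (snd p))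
        = (\<lambda>p. kern (trivial_extension G) (fst p) (snd p))"
      by (auto simp: h_def l_def trivial_extension_def fun_eq_iff split: sum.splits)
    finally show ?thesis .
  qed
  then show ?thesis
    using assms unfolding measurable_graphex_def
    by (auto simp: base_trivial_extension star_trivial_extension case_prod_beta
        intro!: sigma_finite_sum_measure measurable_case_sum_measure sigma_finite_lborel)
qed

lemma degree_trivial_extension:
  assumes "measurable_graphex G" "p \<in> space (base (trivial_extension G))"
  shows "(\<integral>\<^sup>+q. ennreal (kern (trivial_extension G) p q) \<partial>base (trivial_extension G))
    = case_sum (\<lambda>x. \<integral>\<^sup>+y. ennreal (kern G x y) \<partial>base G) (\<lambda>_. 0) p"
proof -
  have "kern (trivial_extension G) p \<in> borel_measurable (base (trivial_extension G))"
    by (intro borel_measurable_kern_section measurable_graphex_trivial_extension assms)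
  then show ?thesis
    by (auto simp: base_trivial_extension nn_integral_sum_measure split: sum.splits)
qed

lemma marginal_trivial_extension:
  assumes "measurable_graphex G" "p \<in> space (base (trivial_extension G))"
  shows "marginal (trivial_extension G) p = case_sum (marginal G) (\<lambda>_. 0) p"
  using degree_trivial_extension[OF assms]
  by (auto simp: marginal_def star_trivial_extension split: sum.splits)

lemma graphex_norm1_trivial_extension:
  assumes "measurable_graphex G"
  shows "graphex_norm1 (trivial_extension G) = graphex_norm1 G"
proof -
  let ?D = "\<lambda>x. \<integral>\<^sup>+y. ennreal (kern G x y) \<partial>base G"
  have "(\<integral>\<^sup>+p. (\<integral>\<^sup>+q. ennreal (kern (trivial_extension G) p q) \<partial>base (trivial_extension G))
        \<partial>base (trivial_extension G))
      = (\<integral>\<^sup>+p. case_sum ?D (\<lambda>_. 0) p \<partial>base (trivial_extension G))"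
    by (intro nn_integral_cong degree_trivial_extension assms)
  also have "\<dots> = (\<integral>\<^sup>+x. ?D x \<partial>base G)"
    using borel_measurable_degree[OF assms]
    by (simp add: base_trivial_extension nn_integral_sum_measure measurable_case_sum_measure)
  finally have 1: "(\<integral>\<^sup>+p. (\<integral>\<^sup>+q. ennreal (kern (trivial_extension G) p q) \<partial>base (trivial_extension G))
        \<partial>base (trivial_extension G)) = (\<integral>\<^sup>+x. ?D x \<partial>base G)" .
  have "star (trivial_extension G) \<in> borel_measurable (sum_measure (base G) lborel)"
    using measurable_graphex_trivial_extension[OF assms]
    by (simp add: measurable_graphex_def base_trivial_extension)
  then have 2: "(\<integral>\<^sup>+p. ennreal (star (trivial_extension G) p) \<partial>base (trivial_extension G))
      = (\<integral>\<^sup>+x. ennreal (star G x) \<partial>base G)"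
    by (simp add: base_trivial_extension nn_integral_sum_measure star_trivial_extension)
  show ?thesis
    using assms by (simp add: graphex_norm1_iterated measurable_graphex_trivial_extension 1 2
        isol_trivial_extension)
qed


section \<open>Measures dominated up to a small mass\<close>

lemma measure_within_mono:
  assumes "measure_within M r N" "r \<le> s"
  shows "measure_within M s N"
  using assms unfolding measure_within_def by (meson add_left_mono ennreal_leI order_trans)

text \<open>Since \<open>N\<close> is dominated by \<open>M\<close>, a Radon-Nikodym density may be
  cut at 1 without changing \<open>N\<close>. The bound on the deficit \<open>1 - g\<close> holds on
  sets of finite mass, where the mass under \<open>N\<close> can be cancelled, and extends by
  monotone convergence.\<close>

lemma measure_within_density:
  assumes "measure_within M r N" and "sigma_finite_measure M"
  obtains g :: "'a \<Rightarrow> ennreal" where "g \<in> borel_measurable M" "\<And>x. g x \<le> 1"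
    "N = density M g" "(\<integral>\<^sup>+x. (1 - g x) \<partial>M) \<le> ennreal r"
proof -
  interpret M: sigma_finite_measure M by fact
  have sets: "sets N = sets M"
    and le: "\<And>B. B \<in> sets M \<Longrightarrow> emeasure N B \<le> emeasure M B"
    and ge: "\<And>B. B \<in> sets M \<Longrightarrow> emeasure M B \<le> emeasure N B + ennreal r"
    using assms(1) by (auto simp: measure_within_def)
  have "absolutely_continuous M N"
    using le unfolding absolutely_continuous_def null_sets_def by (force simp: sets)
  from M.Radon_Nikodym[OF this sets] obtain f
    where f [measurable]: "f \<in> borel_measurable M" and N: "N = density M f" by metis
  define g where "g x = min (f x) 1" for x
  have g [measurable]: "g \<in> borel_measurable M" and g1: "g x \<le> 1" for x
    by (auto simp: g_def[abs_def])
  have Ng: "N = density M g"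
  proof (rule measure_eqI)
    fix X assume "X \<in> sets N"
    then have X [measurable]: "X \<in> sets M" by (simp add: sets)
    \<comment> \<open>Only here does the cut matter. On \<open>X \<inter> B\<close> the density
      exceeds 1, so \<open>N\<close> is at least \<open>M\<close> there; with the assumed domination
      they coincide, and the density may be replaced by 1.\<close>
    define B where "B = {x\<in>space M. f x > 1}"
    have B [measurable]: "B \<in> sets M" unfolding B_def by measurable
    have "emeasure M (X \<inter> B) = (\<integral>\<^sup>+x. indicator (X \<inter> B) x \<partial>M)" by simp
    also have "\<dots> \<le> (\<integral>\<^sup>+x. f x * indicator (X \<inter> B) x \<partial>M)"
      by (intro nn_integral_mono) (auto simp: B_def indicator_def)
    also have "\<dots> = emeasure N (X \<inter> B)" by (simp add: N emeasure_density)
    finally have XB: "emeasure N (X \<inter> B) = emeasure M (X \<inter> B)" by (intro antisym le) auto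
    have "emeasure N X = emeasure N (X \<inter> B) + emeasure N (X - B)"
      by (subst plus_emeasure) (auto simp: sets Int_Diff_Un)
    also have "\<dots> = (\<integral>\<^sup>+x. indicator (X \<inter> B) x \<partial>M) + (\<integral>\<^sup>+x. f x * indicator (X - B) x \<partial>M)"
      by (simp add: XB) (simp add: N emeasure_density)
    also have "\<dots> = (\<integral>\<^sup>+x. indicator (X \<inter> B) x + f x * indicator (X - B) x \<partial>M)"
      by (subst nn_integral_add) auto
    also have "\<dots> = (\<integral>\<^sup>+x. g x * indicator X x \<partial>M)"
      by (intro nn_integral_cong) (auto simp: g_def B_def indicator_def min_def)
    also have "\<dots> = emeasure (density M g) X" by (simp add: emeasure_density)
    finally show "emeasure N X = emeasure (density M g) X" .
  qed (simp add: sets)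
  obtain A :: "nat \<Rightarrow> _" where A: "range A \<subseteq> sets M" "(\<Union>i. A i) = space M"
    "\<And>i. emeasure M (A i) \<noteq> \<infinity>" "incseq A"
    using M.sigma_finite_incseq by metis
  have [measurable]: "A i \<in> sets M" for i using A(1) by auto
  have bound: "(\<integral>\<^sup>+x. (1 - g x) * indicator (A i) x \<partial>M) \<le> ennreal r" for i
  proof -
    have fin: "emeasure N (A i) \<noteq> \<infinity>"
      using le[of "A i"] A(3)[of i] by (auto simp: top_unique)
    have "emeasure N (A i) + (\<integral>\<^sup>+x. (1 - g x) * indicator (A i) x \<partial>M)
        = (\<integral>\<^sup>+x. g x * indicator (A i) x + (1 - g x) * indicator (A i) x \<partial>M)"
      by (subst nn_integral_add) (auto simp: Ng emeasure_density)
    also have "\<dots> = (\<integral>\<^sup>+x. indicator (A i) x \<partial>M)"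
      using g1 by (intro nn_integral_cong)
        (auto simp: indicator_def add_diff_inverse_ennreal diff_add_cancel_ennreal add.commute)
    also have "\<dots> = emeasure M (A i)" by simp
    also have "\<dots> \<le> emeasure N (A i) + ennreal r" by (rule ge) auto
    finally show ?thesis using fin by (simp add: ennreal_add_left_cancel_le)
  qed
  have "(\<integral>\<^sup>+x. (1 - g x) \<partial>M) = (\<integral>\<^sup>+x. (SUP i. (1 - g x) * indicator (A i) x) \<partial>M)"
  proof (intro nn_integral_cong antisym SUP_least)
    fix x assume "x \<in> space M"
    then obtain i where "x \<in> A i" using A(2) by blast
    then show "1 - g x \<le> (SUP i. (1 - g x) * indicator (A i) x)"
      by (intro SUP_upper2[of i]) auto
  qed (auto simp: indicator_def)
  also have "\<dots> = (SUP i. \<integral>\<^sup>+x. (1 - g x) * indicator (A i) x \<partial>M)"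
    using A(4) by (intro nn_integral_monotone_convergence_SUP)
      (auto simp: incseq_def le_fun_def indicator_def)
  also have "\<dots> \<le> ennreal r" by (intro SUP_least bound)
  finally show ?thesis using that g g1 Ng by blast
qed

lemma nn_integral_measure_within_le:
  assumes "measure_within M r N" "sigma_finite_measure M" "f \<in> borel_measurable M"
  shows "(\<integral>\<^sup>+x. f x \<partial>N) \<le> (\<integral>\<^sup>+x. f x \<partial>M)"
proof -
  obtain g :: "_ \<Rightarrow> ennreal" where g: "g \<in> borel_measurable M" "\<And>x. g x \<le> 1" "N = density M g"
    using measure_within_density[OF assms(1,2)] by metis
  have "(\<integral>\<^sup>+x. f x \<partial>N) = (\<integral>\<^sup>+x. g x * f x \<partial>M)"
    unfolding g(3) by (rule nn_integral_density[OF g(1) assms(3)])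
  also have "\<dots> \<le> (\<integral>\<^sup>+x. f x \<partial>M)"
    using mult_right_mono[OF g(2)] by (intro nn_integral_mono) simp
  finally show ?thesis .
qed

lemma sigma_finite_measure_within:
  assumes "measure_within M r N" "sigma_finite_measure M"
  shows "sigma_finite_measure N"
proof -
  have sets: "sets N = sets M" and le: "\<And>B. B \<in> sets M \<Longrightarrow> emeasure N B \<le> emeasure M B"
    using assms(1) by (auto simp: measure_within_def)
  obtain A where A: "countable A" "A \<subseteq> sets M" "\<Union>A = space M" "\<forall>a\<in>A. emeasure M a \<noteq> \<infinity>"
    using assms(2) unfolding sigma_finite_measure_def by blast
  have "\<forall>a\<in>A. emeasure N a \<noteq> \<infinity>"
    using A(2,4) le by (metis infinity_ennreal_def subsetD top.extremum_uniqueI)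
  with A show ?thesis
    unfolding sigma_finite_measure_def using sets_eq_imp_space_eq[OF sets] sets by auto
qed

text \<open>For \<open>f\<close> a marginal this is the integral in the definition of uniform
  integrability. A negative \<open>K\<close> acts as 0.\<close>

definition tail_integral :: "'a measure \<Rightarrow> ('a \<Rightarrow> ennreal) \<Rightarrow> real \<Rightarrow> ennreal" where
  "tail_integral M f K = (\<integral>\<^sup>+x. f x * indicator {x. f x > ennreal K} x \<partial>M)"

lemma tail_integral_antimono: "K \<le> L \<Longrightarrow> tail_integral M f L \<le> tail_integral M f K"
  unfolding tail_integral_def
  by (intro nn_integral_mono) (auto simp: indicator_def intro: ennreal_leI order_le_less_trans)

lemma tail_integral_mono:
  "(\<And>x. x \<in> space M \<Longrightarrow> f x \<le> h x) \<Longrightarrow> tail_integral M f K \<le> tail_integral M h K"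
  unfolding tail_integral_def
  by (intro nn_integral_mono) (auto simp: indicator_def intro: order_less_le_trans)

lemma tail_integral_measure_within_le:
  assumes "measure_within M r N" "sigma_finite_measure M" and [measurable]: "f \<in> borel_measurable M"
  shows "tail_integral N f K \<le> tail_integral M f K"
proof -
  have "(\<lambda>x. f x * indicator {x. f x > ennreal K} x) \<in> borel_measurable M"
    unfolding indicator_def by measurable
  then show ?thesis
    unfolding tail_integral_def by (rule nn_integral_measure_within_le[OF assms(1,2)])
qed

text \<open>Dominated convergence along integer levels: an integrable \<open>f\<close> is finite
  almost everywhere, so at almost every point the integrand is eventually 0.\<close>

lemma tail_integral_less:
  assumes f [measurable]: "f \<in> borel_measurable M" and fin: "(\<integral>\<^sup>+x. f x \<partial>M) < \<infinity>" and "0 < \<epsilon>"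
  obtains K where "0 \<le> K" "tail_integral M f K < \<epsilon>"
proof -
  have "(\<lambda>n. \<integral>\<^sup>+x. f x * indicator {x. f x > ennreal (real n)} x \<partial>M) \<longlonglongrightarrow> (\<integral>\<^sup>+x. 0 \<partial>M)"
  proof (rule nn_integral_dominated_convergence[where w=f])
    show "(\<lambda>x. f x * indicator {x. f x > ennreal (real n)} x) \<in> borel_measurable M" for n
      unfolding indicator_def by measurable
    have "AE x in M. f x \<noteq> \<infinity>" using fin by (intro nn_integral_PInf_AE) auto
    then show "AE x in M. (\<lambda>n. f x * indicator {x. f x > ennreal (real n)} x) \<longlonglongrightarrow> 0"
    proof eventually_elim
      case (elim x)
      then obtain m :: nat where "f x < of_nat m"
        using ennreal_Ex_less_of_nat[of "f x"] by (auto simp: less_top)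
      then have "f x * indicator {x. f x > ennreal (real n)} x = 0" if "m \<le> n" for n
        using that by (auto simp: indicator_def ennreal_of_nat_eq_real_of_nat not_less
            intro: order_trans[OF less_imp_le] ennreal_leI)
      then show ?case
        by (intro tendsto_eventually) (auto simp: eventually_sequentially)
    qed
  qed (use fin in \<open>auto simp: indicator_def\<close>)
  then have "\<forall>\<^sub>F n in sequentially. tail_integral M f (real n) < \<epsilon>"
    using \<open>0 < \<epsilon>\<close> unfolding tail_integral_def by (intro order_tendstoD) auto
  then obtain n where "tail_integral M f (real n) < \<epsilon>"
    by (auto simp: eventually_sequentially)
  then show ?thesis using that[of "real n"] by simp
qed

text \<open>Where \<open>f\<close> exceeds \<open>K\<close>, the factor \<open>1 - g\<close> is
  bounded by 1 and the tail pays; elsewhere \<open>f\<close> is bounded by \<open>K\<close> and the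
  deficit has total mass at most \<open>r\<close>.\<close>

lemma nn_integral_deficit_le:
  assumes [measurable]: "f \<in> borel_measurable M" "g \<in> borel_measurable M" and "0 \<le> K"
    and g: "(\<integral>\<^sup>+x. (1 - g x) \<partial>M) \<le> ennreal r"
  shows "(\<integral>\<^sup>+x. f x * (1 - g x) \<partial>M) \<le> tail_integral M f K + ennreal K * ennreal r"
proof -
  have le1: "1 - g x \<le> 1" for x by (rule diff_le_self_ennreal)
  have "f x * (1 - g x) \<le> f x * indicator {x. f x > ennreal K} x + ennreal K * (1 - g x)" for x
  proof (cases "f x > ennreal K")
    case True
    have "f x * (1 - g x) \<le> f x * 1" by (intro mult_left_mono le1) auto
    with True show ?thesis by (simp add: add_increasing2)
  qed (auto intro!: mult_right_mono)
  then have "(\<integral>\<^sup>+x. f x * (1 - g x) \<partial>M)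
      \<le> (\<integral>\<^sup>+x. f x * indicator {x. f x > ennreal K} x + ennreal K * (1 - g x) \<partial>M)"
    by (intro nn_integral_mono)
  also have "\<dots> = tail_integral M f K + ennreal K * (\<integral>\<^sup>+x. (1 - g x) \<partial>M)"
  proof -
    have "(\<lambda>x. f x * indicator {x. f x > ennreal K} x) \<in> borel_measurable M"
      unfolding indicator_def by measurable
    then show ?thesis
      unfolding tail_integral_def by (subst nn_integral_add) (auto simp: nn_integral_cmult)
  qed
  also have "\<dots> \<le> tail_integral M f K + ennreal K * ennreal r"
    by (intro add_left_mono mult_left_mono g) auto
  finally show ?thesis .
qed

text \<open>The special case of the deficit bound in which the tail above \<open>K\<close>
  vanishes.\<close>

lemma nn_integral_measure_within_ge:
  assumes "measure_within M r N" "sigma_finite_measure M" and f [measurable]: "f \<in> borel_measurable M"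
    and bound: "\<And>x. x \<in> space M \<Longrightarrow> f x \<le> ennreal K" and "0 \<le> K"
  shows "(\<integral>\<^sup>+x. f x \<partial>M) \<le> (\<integral>\<^sup>+x. f x \<partial>N) + ennreal K * ennreal r"
proof -
  obtain g :: "_ \<Rightarrow> ennreal" where g [measurable]: "g \<in> borel_measurable M"
    and g1: "\<And>x. g x \<le> 1" and N: "N = density M g" and d: "(\<integral>\<^sup>+x. (1 - g x) \<partial>M) \<le> ennreal r"
    using measure_within_density[OF assms(1,2)] by metis
  have "(\<integral>\<^sup>+x. f x \<partial>M) = (\<integral>\<^sup>+x. g x * f x + f x * (1 - g x) \<partial>M)"
  proof (rule nn_integral_cong)
    show "f x = g x * f x + f x * (1 - g x)" for x
      using g1[of x] by (simp add: mult.commute[of "g x"] distrib_left[symmetric]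
          add_diff_inverse_ennreal)
  qed
  also have "\<dots> = (\<integral>\<^sup>+x. f x \<partial>N) + (\<integral>\<^sup>+x. f x * (1 - g x) \<partial>M)"
    by (subst nn_integral_add) (auto simp: N nn_integral_density)
  also have "\<dots> \<le> (\<integral>\<^sup>+x. f x \<partial>N) + (tail_integral M f K + ennreal K * ennreal r)"
    using d \<open>0 \<le> K\<close> by (intro add_left_mono nn_integral_deficit_le) auto
  also have "tail_integral M f K = (\<integral>\<^sup>+x. 0 \<partial>M)"
    unfolding tail_integral_def using bound
    by (intro nn_integral_cong) (auto simp: indicator_def not_less[symmetric])
  finally show ?thesis by simp
qed

text \<open>Serves to bound the norm of \<open>H\<close> before it is known to be finite: it
  suffices to bound the integrals of cut functions over sets of finite mass.\<close>

lemma nn_integral_le_truncations: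
  assumes "sigma_finite_measure M" and [measurable]: "f \<in> borel_measurable M"
    and bound: "\<And>(k::nat) A. A \<in> sets M \<Longrightarrow> emeasure M A < \<infinity> \<Longrightarrow>
      (\<integral>\<^sup>+x. min (f x) (of_nat k) * indicator A x \<partial>M) \<le> c"
  shows "(\<integral>\<^sup>+x. f x \<partial>M) \<le> c"
proof -
  interpret sigma_finite_measure M by fact
  obtain A :: "nat \<Rightarrow> _" where A: "range A \<subseteq> sets M" "(\<Union>i. A i) = space M"
    "\<And>i. emeasure M (A i) \<noteq> \<infinity>" "incseq A"
    using sigma_finite_incseq by metis
  have [measurable]: "A i \<in> sets M" for i using A(1) by auto
  have "(\<integral>\<^sup>+x. f x \<partial>M) \<le> (\<integral>\<^sup>+x. (SUP i. min (f x) (of_nat i) * indicator (A i) x) \<partial>M)"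
  \<comment> \<open>Arguing with each \<open>y < f x\<close> treats finite and infinite values of
    \<open>f x\<close> alike: such a \<open>y\<close> is finite and lies below some natural
    number.\<close>
  proof (rule nn_integral_mono, rule dense_le)
    fix x y assume x: "x \<in> space M" and y: "y < f x"
    then obtain i where i: "x \<in> A i" using A(2) by blast
    obtain m :: nat where m: "y < of_nat m"
      using order_less_le_trans[OF y top_greatest] ennreal_Ex_less_of_nat[of y]
      by (auto simp: less_top)
    let ?n = "max i m"
    have "x \<in> A ?n" using i incseqD[OF A(4), of i ?n] by auto
    moreover have "(of_nat m :: ennreal) \<le> of_nat ?n" by (intro of_nat_mono) simp
    ultimately have "y \<le> min (f x) (of_nat ?n) * indicator (A ?n) x"
      using y m by (simp add: less_imp_le order_trans[OF less_imp_le])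
    then show "y \<le> (SUP i. min (f x) (of_nat i) * indicator (A i) x)"
      by (rule SUP_upper2[rotated]) simp
  qed
  also have "\<dots> = (SUP i. \<integral>\<^sup>+x. min (f x) (of_nat i) * indicator (A i) x \<partial>M)"
  proof (intro nn_integral_monotone_convergence_SUP)
    show "incseq (\<lambda>i x. min (f x) (of_nat i) * indicator (A i) x)"
    proof (intro incseq_SucI le_funI mult_mono min.mono order_refl)
      show "indicator (A i) x \<le> (indicator (A (Suc i)) x :: ennreal)" for i x
        using incseq_SucD[OF A(4), of i] by (auto simp: indicator_def)
    qed (auto intro: of_nat_mono)
  qed auto
  also have "\<dots> \<le> c" using A(3) by (intro SUP_least bound) (auto simp: less_top)
  finally show ?thesis .
qed


section \<open>Graphexes over a dominated measure\<close>

context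
  fixes G :: "'a graphex" and r :: real and N :: "'a measure"
  assumes G: "measurable_graphex G" and within: "measure_within (base G) r N"
begin

lemma sets_within: "sets N = sets (base G)"
  using within by (simp add: measure_within_def)

lemmas within_sigma_finite = within sigma_finite_base[OF G]

lemma measurable_graphex_base_update: "measurable_graphex (G\<lparr>base := N\<rparr>)"
  using G sigma_finite_measure_within[OF within_sigma_finite]
  by (simp add: measurable_graphex_def sets_within cong: measurable_cong_sets sets_pair_measure_cong)

lemma degree_base_update_le:
  assumes "x \<in> space (base G)"
  shows "(\<integral>\<^sup>+y. ennreal (kern G x y) \<partial>N) \<le> (\<integral>\<^sup>+y. ennreal (kern G x y) \<partial>base G)"
  using borel_measurable_kern_section[OF G assms]
  by (intro nn_integral_measure_within_le[OF within_sigma_finite]) auto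

lemma marginal_base_update_le:
  "x \<in> space (base G) \<Longrightarrow> marginal (G\<lparr>base := N\<rparr>) x \<le> marginal G x"
  by (auto simp: marginal_def intro!: add_right_mono degree_base_update_le)

lemma tail_integral_base_update_le:
  "tail_integral N (marginal (G\<lparr>base := N\<rparr>)) K \<le> tail_integral (base G) (marginal G) K"
proof -
  have "tail_integral N (marginal (G\<lparr>base := N\<rparr>)) K \<le> tail_integral N (marginal G) K"
    by (intro tail_integral_mono marginal_base_update_le) (simp add: sets_eq_imp_space_eq[OF sets_within])
  also have "\<dots> \<le> tail_integral (base G) (marginal G) K"
    by (intro tail_integral_measure_within_le[OF within_sigma_finite] borel_measurable_marginal G)
  finally show ?thesis .
qed

lemma nn_integral_degree_base_update_le:
  "(\<integral>\<^sup>+x. (\<integral>\<^sup>+y. ennreal (kern G x y) \<partial>N) \<partial>N)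
    \<le> (\<integral>\<^sup>+x. (\<integral>\<^sup>+y. ennreal (kern G x y) \<partial>base G) \<partial>base G)"
proof -
  have "(\<integral>\<^sup>+x. (\<integral>\<^sup>+y. ennreal (kern G x y) \<partial>N) \<partial>N)
      \<le> (\<integral>\<^sup>+x. (\<integral>\<^sup>+y. ennreal (kern G x y) \<partial>base G) \<partial>N)"
    by (intro nn_integral_mono degree_base_update_le)
      (simp add: sets_eq_imp_space_eq[OF sets_within])
  also have "\<dots> \<le> (\<integral>\<^sup>+x. (\<integral>\<^sup>+y. ennreal (kern G x y) \<partial>base G) \<partial>base G)"
    by (intro nn_integral_measure_within_le[OF within_sigma_finite] borel_measurable_degree G)
  finally show ?thesis .
qed

lemma nn_integral_star_base_update_le:
  "(\<integral>\<^sup>+x. ennreal (star G x) \<partial>N) \<le> (\<integral>\<^sup>+x. ennreal (star G x) \<partial>base G)"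
  by (intro nn_integral_measure_within_le[OF within_sigma_finite] borel_measurable_star G)

lemma graphex_norm1_base_update_le: "graphex_norm1 (G\<lparr>base := N\<rparr>) \<le> graphex_norm1 G"
  using nn_integral_degree_base_update_le nn_integral_star_base_update_le
  by (auto simp: graphex_norm1_iterated[OF G] graphex_norm1_iterated[OF measurable_graphex_base_update]
      intro!: add_mono mult_left_mono)

text \<open>Shrinking the measure decreases the integral of the marginal by at most as much as the
  norm, as stars are counted twice in the norm but only once in the marginal.\<close>

lemma nn_integral_marginal_base_update:
  "(\<integral>\<^sup>+x. marginal G x \<partial>base G) + graphex_norm1 (G\<lparr>base := N\<rparr>)
    \<le> (\<integral>\<^sup>+x. marginal (G\<lparr>base := N\<rparr>) x \<partial>N) + graphex_norm1 G"
  using nn_integral_star_base_update_le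
  by (auto simp: graphex_norm1_marginal[OF G] graphex_norm1_marginal[OF measurable_graphex_base_update]
      add.assoc add.left_commute intro!: add_left_mono add_mono)

text \<open>The outer integrand is at most \<open>k\<close>, so changing the outer measure costs at
  most \<open>k * r\<close>. Changing the inner measure costs at most \<open>r\<close> at each
  point, and only points of \<open>A\<close> count. Stars enter with factor 2, as in the norm, so
  that removing the cut gives the norm without its \<open>isol\<close> term.\<close>

lemma graphex_norm1_truncation_le:
  assumes kern: "\<And>x y. x \<in> space (base G) \<Longrightarrow> y \<in> space (base G) \<Longrightarrow> kern G x y \<le> 1"
    and A: "A \<in> sets (base G)"
  shows "(\<integral>\<^sup>+x. min ((\<integral>\<^sup>+y. ennreal (kern G x y) \<partial>base G) + 2 * ennreal (star G x)) (of_nat k)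
        * indicator A x \<partial>base G) + 2 * ennreal (isol G)
    \<le> graphex_norm1 (G\<lparr>base := N\<rparr>) + ennreal r * (of_nat k + emeasure (base G) A)"
    (is "(\<integral>\<^sup>+x. ?f x \<partial>_) + _ \<le> _")
proof -
  let ?w = "\<lambda>x. \<integral>\<^sup>+y. ennreal (kern G x y) \<partial>base G" and ?wN = "\<lambda>x. \<integral>\<^sup>+y. ennreal (kern G x y) \<partial>N"
  have sp: "space N = space (base G)" by (rule sets_eq_imp_space_eq[OF sets_within])
  have [measurable]: "?w \<in> borel_measurable (base G)" "(\<lambda>x. ennreal (star G x)) \<in> borel_measurable (base G)"
    "A \<in> sets (base G)" "A \<in> sets N"
    using borel_measurable_degree[OF G] borel_measurable_star[OF G] A by (auto simp: sets_within)
  have wN [measurable]: "?wN \<in> borel_measurable N" "(\<lambda>x. ennreal (star G x)) \<in> borel_measurable N"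
    using borel_measurable_degree[OF measurable_graphex_base_update]
      borel_measurable_star[OF measurable_graphex_base_update] by auto
  have "(\<integral>\<^sup>+x. ?f x \<partial>base G) \<le> (\<integral>\<^sup>+x. ?f x \<partial>N) + ennreal (real k) * ennreal r"
    by (intro nn_integral_measure_within_ge[OF within_sigma_finite])
      (auto simp: indicator_def ennreal_of_nat_eq_real_of_nat)
  also have "(\<integral>\<^sup>+x. ?f x \<partial>N)
      \<le> (\<integral>\<^sup>+x. ?wN x + 2 * ennreal (star G x) + ennreal r * indicator A x \<partial>N)"
  proof (rule nn_integral_mono)
    fix x assume "x \<in> space N"
    then have x: "x \<in> space (base G)" by (simp add: sp)
    \<comment> \<open>The factor 1 is the bound on the kernel.\<close>
    have "?w x \<le> ?wN x + ennreal 1 * ennreal r"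
      using borel_measurable_kern_section[OF G x] kern[OF x]
      by (intro nn_integral_measure_within_ge[OF within_sigma_finite]) (auto intro: ennreal_leI)
    then have "?w x + 2 * ennreal (star G x) \<le> ?wN x + ennreal r + 2 * ennreal (star G x)"
      by (intro add_right_mono) simp
    also have "\<dots> = ?wN x + 2 * ennreal (star G x) + ennreal r" by (simp only: ac_simps)
    finally show "?f x \<le> ?wN x + 2 * ennreal (star G x) + ennreal r * indicator A x"
      by (cases "x \<in> A") (simp_all add: min.coboundedI1)
  qed
  also have "\<dots> = (\<integral>\<^sup>+x. ?wN x \<partial>N) + 2 * (\<integral>\<^sup>+x. ennreal (star G x) \<partial>N) + ennreal r * emeasure N A"
    by (simp add: nn_integral_add nn_integral_cmult)
  also have "\<dots> \<le> (\<integral>\<^sup>+x. ?wN x \<partial>N) + 2 * (\<integral>\<^sup>+x. ennreal (star G x) \<partial>N)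
      + ennreal r * emeasure (base G) A"
    using within A by (intro add_left_mono mult_left_mono) (auto simp: measure_within_def)
  finally have "(\<integral>\<^sup>+x. ?f x \<partial>base G) + 2 * ennreal (isol G) \<le> (\<integral>\<^sup>+x. ?wN x \<partial>N)
      + 2 * (\<integral>\<^sup>+x. ennreal (star G x) \<partial>N) + ennreal r * emeasure (base G) A
      + ennreal (real k) * ennreal r + 2 * ennreal (isol G)"
    by (simp add: add_right_mono)
  also have "\<dots> = graphex_norm1 (G\<lparr>base := N\<rparr>) + ennreal r * (of_nat k + emeasure (base G) A)"
    by (simp add: graphex_norm1_iterated[OF measurable_graphex_base_update] distrib_left
        ennreal_of_nat_eq_real_of_nat mult.commute ac_simps)
  finally show ?thesis .
qed

text \<open>By symmetry of the kernel, the norm lost when passing to the density \<open>g\<close> is at most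
  \<open>2 * (\<integral>\<^sup>+x. marginal G x * (1 - g x) \<partial>base G)\<close>, since
  \<open>1 - g x * g y \<le> (1 - g x) + (1 - g y)\<close>.\<close>

lemma graphex_norm1_le_base_update:
  assumes sym: "\<And>x y. x \<in> space (base G) \<Longrightarrow> y \<in> space (base G) \<Longrightarrow> kern G x y = kern G y x"
    and "0 \<le> K"
  shows "graphex_norm1 G \<le> graphex_norm1 (G\<lparr>base := N\<rparr>)
    + 2 * (tail_integral (base G) (marginal G) K + ennreal K * ennreal r)"
proof -
  let ?M = "base G"
  let ?W = "\<lambda>x y. ennreal (kern G x y)" and ?S = "\<lambda>x. ennreal (star G x)"
  let ?w = "\<lambda>x. \<integral>\<^sup>+y. ?W x y \<partial>?M"
  interpret M: sigma_finite_measure ?M by (rule sigma_finite_base[OF G])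
  interpret MM: pair_sigma_finite ?M ?M ..
  obtain g :: "_ \<Rightarrow> ennreal" where g [measurable]: "g \<in> borel_measurable ?M"
    and g1: "\<And>x. g x \<le> 1" and N: "N = density ?M g" and d: "(\<integral>\<^sup>+x. (1 - g x) \<partial>?M) \<le> ennreal r"
    using measure_within_density[OF within_sigma_finite] by metis
  have "(\<lambda>(x, y). kern G x y) \<in> borel_measurable (?M \<Otimes>\<^sub>M ?M)"
    using G by (simp add: measurable_graphex_def)
  from measurable_compose[OF this measurable_ennreal]
  have W [measurable]: "(\<lambda>(x, y). ?W x y) \<in> borel_measurable (?M \<Otimes>\<^sub>M ?M)"
    by (simp add: case_prod_beta)
  have [measurable]: "?w \<in> borel_measurable ?M" "?S \<in> borel_measurable ?M" "marginal G \<in> borel_measurable ?M"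
    using borel_measurable_degree[OF G] borel_measurable_star[OF G] borel_measurable_marginal[OF G] by auto
  have Wx [measurable]: "?W x \<in> borel_measurable ?M" if "x \<in> space ?M" for x
    using borel_measurable_kern_section[OF G that] by measurable
  have split: "t = g x * t + t * (1 - g x)" for t x
    using g1[of x] by (simp add: mult.commute[of "g x"] distrib_left[symmetric] add_diff_inverse_ennreal)
  have split_int: "(\<integral>\<^sup>+x. f x \<partial>?M) = (\<integral>\<^sup>+x. g x * f x \<partial>?M) + (\<integral>\<^sup>+x. f x * (1 - g x) \<partial>?M)"
    if [measurable]: "f \<in> borel_measurable ?M" for f
    by (subst nn_integral_add[symmetric]) (auto intro!: nn_integral_cong split)
  \<comment> \<open>The outer factor \<open>g x\<close> is kept while the inner integral is split
    into its part over \<open>N\<close> and a deficit.\<close>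
  have "(\<integral>\<^sup>+x. g x * ?w x \<partial>?M)
      = (\<integral>\<^sup>+x. g x * (\<integral>\<^sup>+y. g y * ?W x y \<partial>?M) + g x * (\<integral>\<^sup>+y. ?W x y * (1 - g y) \<partial>?M) \<partial>?M)"
    by (intro nn_integral_cong) (simp add: split_int[OF Wx] distrib_left)
  also have "\<dots> = (\<integral>\<^sup>+x. g x * (\<integral>\<^sup>+y. g y * ?W x y \<partial>?M) \<partial>?M)
      + (\<integral>\<^sup>+x. g x * (\<integral>\<^sup>+y. ?W x y * (1 - g y) \<partial>?M) \<partial>?M)"
    using W by (intro nn_integral_add) measurable
  also have "(\<integral>\<^sup>+x. g x * (\<integral>\<^sup>+y. g y * ?W x y \<partial>?M) \<partial>?M) = (\<integral>\<^sup>+x. (\<integral>\<^sup>+y. ?W x y \<partial>N) \<partial>N)"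
  proof -
    have "(\<integral>\<^sup>+y. g y * ?W x y \<partial>?M) = (\<integral>\<^sup>+y. ?W x y \<partial>N)" if "x \<in> space ?M" for x
      unfolding N by (rule nn_integral_density[symmetric]) (use Wx[OF that] in auto)
    then have "(\<integral>\<^sup>+x. g x * (\<integral>\<^sup>+y. g y * ?W x y \<partial>?M) \<partial>?M) = (\<integral>\<^sup>+x. g x * (\<integral>\<^sup>+y. ?W x y \<partial>N) \<partial>?M)"
      by (intro nn_integral_cong) simp
    also have "\<dots> = (\<integral>\<^sup>+x. (\<integral>\<^sup>+y. ?W x y \<partial>N) \<partial>N)"
    proof -
      have "(\<lambda>x. \<integral>\<^sup>+y. ?W x y \<partial>N) \<in> borel_measurable ?M"
        using borel_measurable_degree[OF measurable_graphex_base_update]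
        by (simp add: sets_within cong: measurable_cong_sets)
      then show ?thesis
        by (subst (2) N) (rule nn_integral_density[symmetric], auto)
    qed
    finally show ?thesis .
  qed
  also have "(\<integral>\<^sup>+x. g x * (\<integral>\<^sup>+y. ?W x y * (1 - g y) \<partial>?M) \<partial>?M)
      \<le> (\<integral>\<^sup>+x. (\<integral>\<^sup>+y. ?W x y * (1 - g y) \<partial>?M) \<partial>?M)"
    using mult_right_mono[OF g1] by (intro nn_integral_mono) simp
  \<comment> \<open>Interchanging the integrals moves the deficit to the outer variable; symmetry of
    the kernel then turns the inner integral back into a degree.\<close>
  also have "(\<integral>\<^sup>+x. (\<integral>\<^sup>+y. ?W x y * (1 - g y) \<partial>?M) \<partial>?M)
      = (\<integral>\<^sup>+y. (\<integral>\<^sup>+x. ?W x y * (1 - g y) \<partial>?M) \<partial>?M)"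
    using W by (intro MM.Fubini'[symmetric]) measurable
  also have "\<dots> = (\<integral>\<^sup>+y. ?w y * (1 - g y) \<partial>?M)"
  proof (intro nn_integral_cong)
    fix y assume y: "y \<in> space ?M"
    have "(\<integral>\<^sup>+x. ?W x y * (1 - g y) \<partial>?M) = (\<integral>\<^sup>+x. ?W y x * (1 - g y) \<partial>?M)"
      using sym y by (intro nn_integral_cong) simp
    also have "\<dots> = ?w y * (1 - g y)" by (rule nn_integral_multc[OF Wx[OF y]])
    finally show "(\<integral>\<^sup>+x. ?W x y * (1 - g y) \<partial>?M) = ?w y * (1 - g y)" .
  qed
  finally have "(\<integral>\<^sup>+x. g x * ?w x \<partial>?M) \<le> (\<integral>\<^sup>+x. (\<integral>\<^sup>+y. ?W x y \<partial>N) \<partial>N) + (\<integral>\<^sup>+y. ?w y * (1 - g y) \<partial>?M)"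
    by simp
  \<comment> \<open>One deficit is that of the inner variable just treated, the other arises from
    splitting the outer integral.\<close>
  then have w: "(\<integral>\<^sup>+x. ?w x \<partial>?M)
      \<le> (\<integral>\<^sup>+x. (\<integral>\<^sup>+y. ?W x y \<partial>N) \<partial>N) + 2 * (\<integral>\<^sup>+x. ?w x * (1 - g x) \<partial>?M)"
    by (subst split_int) (auto simp: mult_2 add.assoc[symmetric] intro!: add_right_mono)
  have S: "(\<integral>\<^sup>+x. ?S x \<partial>?M) = (\<integral>\<^sup>+x. ?S x \<partial>N) + (\<integral>\<^sup>+x. ?S x * (1 - g x) \<partial>?M)"
    by (subst split_int) (auto simp: N nn_integral_density)
  have "graphex_norm1 G \<le> (\<integral>\<^sup>+x. (\<integral>\<^sup>+y. ?W x y \<partial>N) \<partial>N) + 2 * (\<integral>\<^sup>+x. ?w x * (1 - g x) \<partial>?M)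
      + 2 * ((\<integral>\<^sup>+x. ?S x \<partial>N) + (\<integral>\<^sup>+x. ?S x * (1 - g x) \<partial>?M)) + 2 * ennreal (isol G)"
    unfolding graphex_norm1_iterated[OF G] S[symmetric] by (intro add_right_mono w)
  also have "\<dots> = graphex_norm1 (G\<lparr>base := N\<rparr>)
      + 2 * ((\<integral>\<^sup>+x. ?w x * (1 - g x) \<partial>?M) + (\<integral>\<^sup>+x. ?S x * (1 - g x) \<partial>?M))"
    by (simp add: graphex_norm1_iterated[OF measurable_graphex_base_update] distrib_left ac_simps)
  also have "(\<integral>\<^sup>+x. ?w x * (1 - g x) \<partial>?M) + (\<integral>\<^sup>+x. ?S x * (1 - g x) \<partial>?M)
      = (\<integral>\<^sup>+x. marginal G x * (1 - g x) \<partial>?M)"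
    by (subst nn_integral_add[symmetric]) (auto simp: marginal_def distrib_right)
  also have "\<dots> \<le> tail_integral ?M (marginal G) K + ennreal K * ennreal r"
    using d \<open>0 \<le> K\<close> by (intro nn_integral_deficit_le) auto
  finally show ?thesis by (simp add: mult_left_mono add_left_mono)
qed

end


section \<open>Consequences of a small distance\<close>

text \<open>\<open>L2_norm\<close> is a Bochner integral with default 0, so a small value says
  something only for square integrable functions. The hypotheses on \<open>p\<close> and
  \<open>q\<close> exclude the default.\<close>

lemma nn_integral_square_diff_eq_L2_norm:
  assumes [measurable]: "p \<in> borel_measurable M" "q \<in> borel_measurable M"
    and p: "(\<integral>\<^sup>+x. (p x)\<^sup>2 \<partial>M) < \<infinity>" and q: "(\<integral>\<^sup>+x. (q x)\<^sup>2 \<partial>M) < \<infinity>"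
  shows "(\<integral>\<^sup>+x. ennreal ((enn2real (p x) - enn2real (q x))\<^sup>2) \<partial>M)
    = ennreal ((L2_norm M (\<lambda>x. enn2real (p x) - enn2real (q x)))\<^sup>2)"
proof -
  let ?d = "\<lambda>x. (enn2real (p x) - enn2real (q x))\<^sup>2"
  have le: "ennreal ((enn2real a)\<^sup>2) \<le> a\<^sup>2" for a :: ennreal
    by (cases a) (auto simp: ennreal_power)
  have "ennreal (norm (?d x)) \<le> (p x)\<^sup>2 + (q x)\<^sup>2" for x
  proof -
    have "?d x \<le> (enn2real (p x))\<^sup>2 + (enn2real (q x))\<^sup>2"
      by (simp add: power2_diff)
    then have "ennreal (norm (?d x)) \<le> ennreal ((enn2real (p x))\<^sup>2 + (enn2real (q x))\<^sup>2)"
      by (simp add: ennreal_leI del: ennreal_plus)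
    also have "\<dots> \<le> (p x)\<^sup>2 + (q x)\<^sup>2" using le[of "p x"] le[of "q x"]
      by (simp add: add_mono)
    finally show ?thesis .
  qed
  then have "(\<integral>\<^sup>+x. ennreal (norm (?d x)) \<partial>M) \<le> (\<integral>\<^sup>+x. (p x)\<^sup>2 + (q x)\<^sup>2 \<partial>M)"
    by (intro nn_integral_mono)
  also have "\<dots> < \<infinity>" using p q by (subst nn_integral_add) auto
  finally have "integrable M ?d" by (intro integrableI_bounded) auto
  then show ?thesis
    by (simp add: nn_integral_eq_integral L2_norm_def)
qed

text \<open>A pointwise inequality takes the place of Cauchy-Schwarz: \<open>p\<close> is at most
  \<open>(p - q)^2 + 1 + q\<close>, and \<open>q\<close> is at most \<open>L\<close> plus its
  tail.\<close>

lemma nn_integral_indicator_le_tail_integral: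
  assumes [measurable]: "p \<in> borel_measurable M" "q \<in> borel_measurable M" "C \<in> sets M"
    and fin: "AE x in M. p x \<noteq> \<infinity>" and "0 \<le> L"
  shows "(\<integral>\<^sup>+x. p x * indicator C x \<partial>M)
    \<le> (\<integral>\<^sup>+x. ennreal ((enn2real (p x) - enn2real (q x))\<^sup>2) \<partial>M)
      + (1 + ennreal L) * emeasure M C + tail_integral M q L"
proof -
  let ?d = "\<lambda>x. ennreal ((enn2real (p x) - enn2real (q x))\<^sup>2)"
  have [measurable]: "(\<lambda>x. q x * indicator {x. q x > ennreal L} x) \<in> borel_measurable M"
    unfolding indicator_def by measurable
  have "(\<integral>\<^sup>+x. p x * indicator C x \<partial>M) \<le> (\<integral>\<^sup>+x. ?d x + (1 + ennreal L) * indicator C x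
      + q x * indicator {x. q x > ennreal L} x \<partial>M)"
  proof (rule nn_integral_mono_AE, use fin in eventually_elim)
    case (elim x)
    then obtain a where a: "p x = ennreal a" "0 \<le> a" by (cases "p x") auto
    \<comment> \<open>The difference of the two sides is
      \<open>(a - b - 1/2)^2 + 3/4\<close>.\<close>
    have sq: "a \<le> (a - b)\<^sup>2 + 1 + b" for b
      using zero_le_power2[of "a - b - 1/2"] by (simp add: power2_eq_square algebra_simps)
    show ?case
    proof (cases "x \<in> C")
      case C: True
      show ?thesis
      proof (cases "q x")
        case (real b)
        have "p x \<le> ennreal ((a - b)\<^sup>2 + 1 + b)" using sq[of b] by (simp add: a ennreal_leI)
        also have "\<dots> = ?d x + 1 + q x"
          using real a by (simp add: ennreal_plus)
        also have "\<dots> \<le> ?d x + 1 + (ennreal L + q x * indicator {x. q x > ennreal L} x)"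
          by (intro add_left_mono) (auto simp: indicator_def)
        finally show ?thesis using C by (simp add: add.assoc)
      \<comment> \<open>If \<open>q x\<close> is infinite, so is the tail term on the right.\<close>
      qed auto
    qed simp
  qed
  also have "\<dots> = (\<integral>\<^sup>+x. ?d x \<partial>M) + (1 + ennreal L) * emeasure M C + tail_integral M q L"
    unfolding tail_integral_def by (simp add: nn_integral_add nn_integral_cmult)
  finally show ?thesis .
qed

text \<open>The star function is below the marginal. Finiteness makes \<open>graphex_rho\<close> a
  faithful copy of the norm, so that closeness of \<open>graphex_rho\<close> can be read as
  closeness of norms.\<close>

lemma graphex_norm1_finite:
  assumes "measurable_graphex G" "graphex_L1_L2 G"
  shows "graphex_norm1 G < \<infinity>"
proof -
  have "(\<integral>\<^sup>+x. ennreal (star G x) \<partial>base G) \<le> (\<integral>\<^sup>+x. marginal G x \<partial>base G)"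
    by (intro nn_integral_mono) (simp add: marginal_def)
  moreover have "(\<integral>\<^sup>+x. marginal G x \<partial>base G) < \<infinity>"
    using assms(2) by (simp add: graphex_L1_L2_def Let_def)
  ultimately show ?thesis
    by (auto simp: graphex_norm1_marginal[OF assms(1)] ennreal_mult_less_top)
qed

lemma ennreal_le_add_of_enn2real_diff:
  assumes "a < \<infinity>" "b < \<infinity>" "\<bar>enn2real a - enn2real b\<bar> \<le> c"
  shows "a \<le> b + ennreal c"
proof -
  obtain x y where xy: "a = ennreal x" "b = ennreal y" "0 \<le> x" "0 \<le> y"
    using assms(1,2) by (cases a; cases b) auto
  have "ennreal x \<le> ennreal (y + c)" using assms(3) xy by (intro ennreal_leI) simp
  also have "\<dots> = ennreal y + ennreal c" using assms(3) xy by (intro ennreal_plus) auto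
  finally show ?thesis using xy by simp
qed

lemma coupling_fst:
  assumes "\<nu> \<in> couplings (base (trivial_extension G)) (base (trivial_extension H))"
  shows "fst \<in> measurable \<nu> (base (trivial_extension G))"
    "distr \<nu> (base (trivial_extension G)) fst = base (trivial_extension G)"
proof -
  have *: "sets \<nu> = sets (base (trivial_extension G) \<Otimes>\<^sub>M base (trivial_extension H))"
    using assms by (simp add: couplings_def)
  show "fst \<in> measurable \<nu> (base (trivial_extension G))"
    unfolding measurable_cong_sets[OF * refl] by (rule measurable_fst)
  show "distr \<nu> (base (trivial_extension G)) fst = base (trivial_extension G)"
    using assms by (simp add: couplings_def)
qed

lemma coupling_snd:
  assumes "\<nu> \<in> couplings (base (trivial_extension G)) (base (trivial_extension H))"
  shows "snd \<in> measurable \<nu> (base (trivial_extension H))"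
    "distr \<nu> (base (trivial_extension H)) snd = base (trivial_extension H)"
proof -
  have *: "sets \<nu> = sets (base (trivial_extension G) \<Otimes>\<^sub>M base (trivial_extension H))"
    using assms by (simp add: couplings_def)
  show "snd \<in> measurable \<nu> (base (trivial_extension H))"
    unfolding measurable_cong_sets[OF * refl] by (rule measurable_snd)
  show "distr \<nu> (base (trivial_extension H)) snd = base (trivial_extension H)"
    using assms by (simp add: couplings_def)
qed

context
  fixes G :: "'a graphex" and H :: "'b graphex" and e :: real
  assumes G: "measurable_graphex G" "graphex_L1_L2 G"
    and H: "measurable_graphex H" "graphex_L1_L2 H"
    and dist: "delta22 G H < ennreal e"
begin

text \<open>The infimum over couplings need not be attained; the strict bound on it yields a
  coupling that still satisfies the bound.\<close>

lemma delta22_coupling: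
  obtains P Q :: "(('a + real) \<times> ('b + real)) graphex" and \<nu>
  where "\<nu> \<in> couplings (base (trivial_extension G)) (base (trivial_extension H))"
    and "P = pullback fst \<nu> (trivial_extension G)" "Q = pullback snd \<nu> (trivial_extension H)"
    and "ennreal (sqrt (L2_norm \<nu> (\<lambda>x. enn2real (marginal P x) - enn2real (marginal Q x)))) < ennreal e"
    and "ennreal (root 3 \<bar>graphex_rho P - graphex_rho Q\<bar>) < ennreal e"
proof -
  obtain \<nu> where \<nu>: "\<nu> \<in> couplings (base (trivial_extension G)) (base (trivial_extension H))"
    and "d22 (pullback fst \<nu> (trivial_extension G)) (pullback snd \<nu> (trivial_extension H)) < ennreal e"
    using dist unfolding delta22_def delta22_tilde_def INF_less_iff by blast
  then show ?thesis using that[OF \<nu> refl refl] by (simp add: d22_def)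
qed

text \<open>Pullbacks and trivial extensions preserve the norm, and \<open>d22\<close> contains the
  cube root of the difference.\<close>

lemma abs_rho_diff_le: "\<bar>graphex_rho G - graphex_rho H\<bar> \<le> e ^ 3"
proof -
  obtain \<nu> P Q where \<nu>: "\<nu> \<in> couplings (base (trivial_extension G)) (base (trivial_extension H))"
    and PQ: "P = pullback fst \<nu> (trivial_extension G)" "Q = pullback snd \<nu> (trivial_extension H)"
    and *: "ennreal (root 3 \<bar>graphex_rho P - graphex_rho Q\<bar>) < ennreal e"
    by (rule delta22_coupling)
  have "graphex_rho P = graphex_rho G" "graphex_rho Q = graphex_rho H"
    using coupling_fst[OF \<nu>] coupling_snd[OF \<nu>] G(1) H(1)
    by (simp_all add: PQ graphex_rho_def graphex_norm1_pullback measurable_graphex_trivial_extension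
        graphex_norm1_trivial_extension)
  with * have "root 3 \<bar>graphex_rho G - graphex_rho H\<bar> \<le> e"
    by (simp add: ennreal_less_iff)
  from power_mono[OF this, of 3] show ?thesis by (simp add: real_root_pow_pos2)
qed

lemma graphex_norm1_le_of_delta22: "graphex_norm1 G \<le> graphex_norm1 H + ennreal (e ^ 3)"
  and graphex_norm1_ge_of_delta22: "graphex_norm1 H \<le> graphex_norm1 G + ennreal (e ^ 3)"
  using abs_rho_diff_le
  by (auto simp: graphex_rho_def abs_minus_commute
      intro!: ennreal_le_add_of_enn2real_diff graphex_norm1_finite G H)

text \<open>The marginal of \<open>G\<close> on a small set is traded for that of \<open>H\<close>.
  On the coupling space both marginals are functions of the same point, so they can be compared
  pointwise over the cylinder \<open>?C\<close> above \<open>B\<close>, which has the same mass as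
  \<open>B\<close>.\<close>

lemma nn_integral_marginal_set_le_of_delta22:
  assumes B: "B \<in> sets (base G)" and "0 \<le> L"
  shows "(\<integral>\<^sup>+x. marginal G x * indicator B x \<partial>base G)
    \<le> ennreal (e ^ 4) + (1 + ennreal L) * emeasure (base G) B + tail_integral (base H) (marginal H) L"
proof -
  let ?G = "trivial_extension G" and ?H = "trivial_extension H"
  obtain \<nu> P Q where \<nu>: "\<nu> \<in> couplings (base ?G) (base ?H)"
    and PQ: "P = pullback fst \<nu> ?G" "Q = pullback snd \<nu> ?H"
    and *: "ennreal (sqrt (L2_norm \<nu> (\<lambda>x. enn2real (marginal P x) - enn2real (marginal Q x)))) < ennreal e"
    by (rule delta22_coupling)
  let ?n = "L2_norm \<nu> (\<lambda>x. enn2real (marginal P x) - enn2real (marginal Q x))"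
  note fst = measurable_graphex_trivial_extension[OF G(1)] coupling_fst[OF \<nu>]
  note snd = measurable_graphex_trivial_extension[OF H(1)] coupling_snd[OF \<nu>]
  have mP [measurable]: "marginal P \<in> borel_measurable \<nu>"
    using borel_measurable_marginal[OF measurable_graphex_pullback[OF fst]] by (simp add: PQ)
  have mQ [measurable]: "marginal Q \<in> borel_measurable \<nu>"
    using borel_measurable_marginal[OF measurable_graphex_pullback[OF snd]] by (simp add: PQ)
  have P: "marginal P z = case_sum (marginal G) (\<lambda>_. 0) (fst z)" if "z \<in> space \<nu>" for z
    using marginal_pullback[OF fst that] measurable_space[OF fst(2) that]
    by (simp add: PQ marginal_trivial_extension G)
  have Q: "marginal Q z = case_sum (marginal H) (\<lambda>_. 0) (snd z)" if "z \<in> space \<nu>" for z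
    using marginal_pullback[OF snd that] measurable_space[OF snd(2) that]
    by (simp add: PQ marginal_trivial_extension H)
  \<comment> \<open>On the adjoined line the extended marginal is 0, so \<open>f 0 = 0\<close>
    removes its infinite mass from the integral.\<close>
  have intP: "(\<integral>\<^sup>+z. f (marginal P z) * h (fst z) \<partial>\<nu>) = (\<integral>\<^sup>+x. f (marginal G x) * h (Inl x) \<partial>base G)"
    if [measurable]: "f \<in> borel_measurable borel" "h \<in> borel_measurable (base ?G)" and "f 0 = 0" for f h
  proof -
    have [measurable]: "case_sum (marginal G) (\<lambda>_. 0) \<in> borel_measurable (base ?G)"
      unfolding base_trivial_extension using borel_measurable_marginal[OF G(1)]
      by (intro measurable_case_sum_measure) auto
    have "(\<integral>\<^sup>+z. f (marginal P z) * h (fst z) \<partial>\<nu>)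
        = (\<integral>\<^sup>+z. f (case_sum (marginal G) (\<lambda>_. 0) (fst z)) * h (fst z) \<partial>\<nu>)"
      by (intro nn_integral_cong) (simp add: P)
    also have "\<dots> = (\<integral>\<^sup>+p. f (case_sum (marginal G) (\<lambda>_. 0) p) * h p \<partial>base ?G)"
      by (intro nn_integral_pullback[OF fst, where f="\<lambda>p. f (case_sum _ _ p) * h p"]) measurable
    also have "\<dots> = (\<integral>\<^sup>+x. f (marginal G x) * h (Inl x) \<partial>base G)"
    proof -
      have "(\<lambda>p. f (case_sum (marginal G) (\<lambda>_. 0) p) * h p) \<in> borel_measurable (base ?G)"
        by measurable
      then show ?thesis
        by (simp add: base_trivial_extension nn_integral_sum_measure \<open>f 0 = 0\<close>)
    qed
    finally show ?thesis .
  qed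
  have intQ: "(\<integral>\<^sup>+z. f (marginal Q z) \<partial>\<nu>) = (\<integral>\<^sup>+x. f (marginal H x) \<partial>base H)"
    if [measurable]: "f \<in> borel_measurable borel" and "f 0 = 0" for f
  proof -
    have [measurable]: "case_sum (marginal H) (\<lambda>_. 0) \<in> borel_measurable (base ?H)"
      unfolding base_trivial_extension using borel_measurable_marginal[OF H(1)]
      by (intro measurable_case_sum_measure) auto
    have "(\<integral>\<^sup>+z. f (marginal Q z) \<partial>\<nu>) = (\<integral>\<^sup>+z. f (case_sum (marginal H) (\<lambda>_. 0) (snd z)) \<partial>\<nu>)"
      by (intro nn_integral_cong) (simp add: Q)
    also have "\<dots> = (\<integral>\<^sup>+p. f (case_sum (marginal H) (\<lambda>_. 0) p) \<partial>base ?H)"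
      by (intro nn_integral_pullback[OF snd, where f="\<lambda>p. f (case_sum _ _ p)"]) measurable
    also have "\<dots> = (\<integral>\<^sup>+x. f (marginal H x) \<partial>base H)"
    proof -
      have "(\<lambda>p. f (case_sum (marginal H) (\<lambda>_. 0) p)) \<in> borel_measurable (base ?H)"
        by measurable
      then show ?thesis
        by (simp add: base_trivial_extension nn_integral_sum_measure \<open>f 0 = 0\<close>)
    qed
    finally show ?thesis .
  qed
  let ?C = "fst -` (Inl ` B) \<inter> space \<nu>"
  have IB: "Inl ` B \<in> sets (base ?G)"
  proof -
    have "Inl ` B = B <+> {}" by auto
    then show ?thesis using B unfolding base_trivial_extension sets_sum_measure_eq by blast
  qed
  have C [measurable]: "?C \<in> sets \<nu>" by (rule measurable_sets[OF fst(2) IB])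
  have indC: "indicator ?C z = (indicator (Inl ` B) (fst z) :: ennreal)" if "z \<in> space \<nu>" for z
    using that by (auto simp: indicator_def)
  have "(\<integral>\<^sup>+x. marginal G x * indicator B x \<partial>base G) = (\<integral>\<^sup>+z. marginal P z * indicator ?C z \<partial>\<nu>)"
    using intP[of "\<lambda>t. t" "indicator (Inl ` B)"] IB
    by (simp add: indC cong: nn_integral_cong) (simp add: indicator_def image_iff)
  also have "\<dots> \<le> (\<integral>\<^sup>+z. ennreal ((enn2real (marginal P z) - enn2real (marginal Q z))\<^sup>2) \<partial>\<nu>)
      + (1 + ennreal L) * emeasure \<nu> ?C + tail_integral \<nu> (marginal Q) L"
  proof (intro nn_integral_indicator_le_tail_integral mP mQ C \<open>0 \<le> L\<close> nn_integral_PInf_AE)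
    show "(\<integral>\<^sup>+z. marginal P z \<partial>\<nu>) \<noteq> \<infinity>"
      using intP[of "\<lambda>t. t" "\<lambda>_. 1"] G(2) by (auto simp: graphex_L1_L2_def Let_def)
  qed
  also have "(\<integral>\<^sup>+z. ennreal ((enn2real (marginal P z) - enn2real (marginal Q z))\<^sup>2) \<partial>\<nu>)
      = ennreal (?n\<^sup>2)"
    using intP[of "\<lambda>t. t\<^sup>2" "\<lambda>_. 1"] intQ[of "\<lambda>t. t\<^sup>2"] G(2) H(2)
    by (intro nn_integral_square_diff_eq_L2_norm mP mQ) (simp_all add: graphex_L1_L2_def Let_def)
  also have "ennreal (?n\<^sup>2) \<le> ennreal (e ^ 4)"
  proof (rule ennreal_leI)
    have "0 \<le> ?n" by (simp add: L2_norm_def)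
    \<comment> \<open>\<open>d22\<close> bounds the square root of the L^2 norm, whereas the
      pointwise comparison needs the square of that norm; hence the fourth power.\<close>
    moreover have "sqrt ?n \<le> e" using * \<open>0 \<le> ?n\<close> by (simp add: ennreal_less_iff)
    from power_mono[OF this, of 4] \<open>0 \<le> ?n\<close> have "(sqrt ?n) ^ 4 \<le> e ^ 4" by simp
    moreover have "(sqrt ?n) ^ 4 = ((sqrt ?n)\<^sup>2)\<^sup>2" by (simp flip: power_mult)
    ultimately show "?n\<^sup>2 \<le> e ^ 4" by simp
  qed
  also have "emeasure \<nu> ?C = emeasure (base G) B"
  proof -
    have "emeasure \<nu> ?C = emeasure (distr \<nu> (base ?G) fst) (Inl ` B)"
      by (rule emeasure_distr[OF fst(2) IB, symmetric])
    also have "\<dots> = emeasure (base ?G) (B <+> {})" using coupling_fst(2)[OF \<nu>] by (simp add: Plus_def)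
    also have "\<dots> = emeasure (base G) B"
      unfolding base_trivial_extension by (subst emeasure_sum_measure) (use B in auto)
    finally show ?thesis .
  qed
  also have "tail_integral \<nu> (marginal Q) L = tail_integral (base H) (marginal H) L"
  proof -
    have "(\<lambda>t. t * indicator {t. t > ennreal L} t) \<in> borel_measurable borel"
      unfolding indicator_def by measurable
    from intQ[OF this] show ?thesis by (simp add: tail_integral_def indicator_def)
  qed
  finally show ?thesis by (simp add: add_right_mono)
qed

end

lemma weak_kernel_dist_lessE:
  assumes "weak_kernel_dist G H < ennreal e"
  obtains M N where "measure_within (base G) (e\<^sup>2) M" "graphex_L1_L2 (G\<lparr>base := M\<rparr>)"
    "measure_within (base H) (e\<^sup>2) N" "graphex_L1_L2 (H\<lparr>base := N\<rparr>)"
    "delta22 (G\<lparr>base := M\<rparr>) (H\<lparr>base := N\<rparr>) < ennreal e"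
proof -
  from assms obtain c M N where c: "0 \<le> c" "ennreal c < ennreal e"
    and within: "measure_within (base G) (c\<^sup>2) M" "measure_within (base H) (c\<^sup>2) N"
    and L: "graphex_L1_L2 (G\<lparr>base := M\<rparr>)" "graphex_L1_L2 (H\<lparr>base := N\<rparr>)"
    and d: "delta22 (G\<lparr>base := M\<rparr>) (H\<lparr>base := N\<rparr>) \<le> ennreal c"
    unfolding weak_kernel_dist_def Inf_less_iff by blast
  have "c\<^sup>2 \<le> e\<^sup>2" using c by (intro power_mono) (auto simp: ennreal_less_iff)
  then show ?thesis
    using that[OF measure_within_mono[OF within(1)] L(1) measure_within_mono[OF within(2)] L(2)
        order_le_less_trans[OF d c(2)]] by blast
qed


section \<open>Estimates at a given weak kernel distance\<close>

context
  fixes G :: "'a graphex" and H :: "'b graphex" and e :: real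
  assumes G: "is_graphex G" and H: "is_graphex H"
    and dist: "weak_kernel_dist G H < ennreal e"
begin

text \<open>Passes from \<open>H\<close> to its smaller measure at the price of the cut, from there
  to the shrunken \<open>G\<close> by \<open>e ^ 3\<close>, and back to \<open>G\<close> by
  monotonicity.\<close>

lemma graphex_norm1_truncation_le_of_dist:
  assumes A: "A \<in> sets (base H)"
  shows "(\<integral>\<^sup>+x. min ((\<integral>\<^sup>+y. ennreal (kern H x y) \<partial>base H) + 2 * ennreal (star H x)) (of_nat k)
        * indicator A x \<partial>base H) + 2 * ennreal (isol H)
    \<le> graphex_norm1 G + ennreal (e ^ 3) + ennreal (e\<^sup>2) * (of_nat k + emeasure (base H) A)"
    (is "?T \<le> _")
proof -
  note mG = is_graphex_measurable[OF G] and mH = is_graphex_measurable[OF H]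
  obtain M N where M: "measure_within (base G) (e\<^sup>2) M" "graphex_L1_L2 (G\<lparr>base := M\<rparr>)"
    and N: "measure_within (base H) (e\<^sup>2) N" "graphex_L1_L2 (H\<lparr>base := N\<rparr>)"
    and d: "delta22 (G\<lparr>base := M\<rparr>) (H\<lparr>base := N\<rparr>) < ennreal e"
    using dist by (rule weak_kernel_dist_lessE)
  have "?T \<le> graphex_norm1 (H\<lparr>base := N\<rparr>) + ennreal (e\<^sup>2) * (of_nat k + emeasure (base H) A)"
    using H by (intro graphex_norm1_truncation_le mH N A) (simp add: is_graphex_def Let_def)
  also have "graphex_norm1 (H\<lparr>base := N\<rparr>) \<le> graphex_norm1 (G\<lparr>base := M\<rparr>) + ennreal (e ^ 3)"
    by (intro graphex_norm1_ge_of_delta22 measurable_graphex_base_update[OF mG M(1)] M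
        measurable_graphex_base_update[OF mH N(1)] N d)
  also have "graphex_norm1 (G\<lparr>base := M\<rparr>) \<le> graphex_norm1 G"
    by (rule graphex_norm1_base_update_le[OF mG M(1)])
  finally show ?thesis by (simp add: add_right_mono)
qed

text \<open>The same chain in the opposite direction; here it is \<open>G\<close> that must not lose
  much, which its own tail controls.\<close>

lemma graphex_norm1_le_of_dist:
  assumes "0 \<le> K"
  shows "graphex_norm1 G \<le> graphex_norm1 H + ennreal (e ^ 3)
    + 2 * (tail_integral (base G) (marginal G) K + ennreal K * ennreal (e\<^sup>2))"
proof -
  note mG = is_graphex_measurable[OF G] and mH = is_graphex_measurable[OF H]
  obtain M N where M: "measure_within (base G) (e\<^sup>2) M" "graphex_L1_L2 (G\<lparr>base := M\<rparr>)"
    and N: "measure_within (base H) (e\<^sup>2) N" "graphex_L1_L2 (H\<lparr>base := N\<rparr>)"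
    and d: "delta22 (G\<lparr>base := M\<rparr>) (H\<lparr>base := N\<rparr>) < ennreal e"
    using dist by (rule weak_kernel_dist_lessE)
  have "graphex_norm1 G \<le> graphex_norm1 (G\<lparr>base := M\<rparr>)
      + 2 * (tail_integral (base G) (marginal G) K + ennreal K * ennreal (e\<^sup>2))"
    using G by (intro graphex_norm1_le_base_update mG M assms) (simp add: is_graphex_def Let_def)
  also have "graphex_norm1 (G\<lparr>base := M\<rparr>) \<le> graphex_norm1 (H\<lparr>base := N\<rparr>) + ennreal (e ^ 3)"
    by (intro graphex_norm1_le_of_delta22 measurable_graphex_base_update[OF mG M(1)] M
        measurable_graphex_base_update[OF mH N(1)] N d)
  also have "graphex_norm1 (H\<lparr>base := N\<rparr>) \<le> graphex_norm1 H"
    by (rule graphex_norm1_base_update_le[OF mH N(1)])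
  finally show ?thesis by (simp add: add_right_mono)
qed

text \<open>The bound involves the tail of \<open>H\<close> but none of \<open>G\<close>. The norm
  lost by \<open>G\<close> is at most \<open>?\<eta>\<close>: by \<open>le\<close> the norm of
  \<open>G\<close> exceeds that of \<open>H\<close> by at most \<open>\<delta>\<close>,
  \<open>H\<close> loses little by its own tail, and over the smaller measures the norms differ by
  at most \<open>e ^ 3\<close>. The remaining terms bound the marginal that survives on the set
  where it exceeded \<open>K\<close>.\<close>

lemma tail_integral_marginal_le_of_dist:
  assumes fin: "graphex_norm1 G < \<infinity>"
    and le: "graphex_norm1 G \<le> graphex_norm1 H + \<delta>"
    and "0 < K" "0 \<le> L"
  shows "tail_integral (base G) (marginal G) K
    \<le> ennreal (e ^ 4) + (1 + ennreal L) * (ennreal (1 / K) * graphex_norm1 G)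
      + tail_integral (base H) (marginal H) L
      + (\<delta> + ennreal (e ^ 3) + 2 * (tail_integral (base H) (marginal H) L + ennreal L * ennreal (e\<^sup>2)))"
    (is "_ \<le> _ + ?\<eta>")
proof -
  note mG = is_graphex_measurable[OF G] and mH = is_graphex_measurable[OF H]
  obtain M N where M: "measure_within (base G) (e\<^sup>2) M" "graphex_L1_L2 (G\<lparr>base := M\<rparr>)"
    and N: "measure_within (base H) (e\<^sup>2) N" "graphex_L1_L2 (H\<lparr>base := N\<rparr>)"
    and d: "delta22 (G\<lparr>base := M\<rparr>) (H\<lparr>base := N\<rparr>) < ennreal e"
    using dist by (rule weak_kernel_dist_lessE)
  let ?G = "G\<lparr>base := M\<rparr>" and ?H = "H\<lparr>base := N\<rparr>"
  note mG' = measurable_graphex_base_update[OF mG M(1)] and mH' = measurable_graphex_base_update[OF mH N(1)]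
  note sf = sigma_finite_base[OF mG]
  have sets_M: "sets M = sets (base G)" using M(1) by (simp add: measure_within_def)
  have space_M: "space M = space (base G)" by (rule sets_eq_imp_space_eq[OF sets_M])
  have m [measurable]: "marginal G \<in> borel_measurable (base G)" by (rule borel_measurable_marginal[OF mG])
  have m' [measurable]: "marginal ?G \<in> borel_measurable M" using borel_measurable_marginal[OF mG'] by simp
  have mM [measurable]: "marginal G \<in> borel_measurable M"
    using m by (simp add: measurable_cong_sets[OF sets_M refl])
  define B where "B = {x \<in> space (base G). marginal G x > ennreal K}"
  have B [measurable]: "B \<in> sets (base G)" unfolding B_def by measurable
  then have BM [measurable]: "B \<in> sets M" "space M - B \<in> sets M" and Bc [measurable]: "space M - B \<in> sets (base G)"
    by (auto simp: sets_M[symmetric])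
  have "graphex_norm1 H \<le> graphex_norm1 ?H
      + 2 * (tail_integral (base H) (marginal H) L + ennreal L * ennreal (e\<^sup>2))"
    using H \<open>0 \<le> L\<close> by (intro graphex_norm1_le_base_update mH N) (simp_all add: is_graphex_def Let_def)
  also have "graphex_norm1 ?H \<le> graphex_norm1 ?G + ennreal (e ^ 3)"
    by (intro graphex_norm1_ge_of_delta22 mG' M mH' N d)
  finally have "graphex_norm1 H \<le> graphex_norm1 ?G + ennreal (e ^ 3)
      + 2 * (tail_integral (base H) (marginal H) L + ennreal L * ennreal (e\<^sup>2))"
    by (simp add: add_right_mono)
  then have "graphex_norm1 H + \<delta> \<le> graphex_norm1 ?G + ennreal (e ^ 3)
      + 2 * (tail_integral (base H) (marginal H) L + ennreal L * ennreal (e\<^sup>2)) + \<delta>"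
    by (rule add_right_mono)
  from order_trans[OF le this] have norm: "graphex_norm1 G \<le> graphex_norm1 ?G + ?\<eta>"
    by (simp only: ac_simps)
  \<comment> \<open>Converts the loss of norm into a loss of marginal mass; the norm of the shrunken
    graphex is finite and cancels.\<close>
  have "(\<integral>\<^sup>+x. marginal G x \<partial>base G) + graphex_norm1 ?G
      \<le> (\<integral>\<^sup>+x. marginal ?G x \<partial>M) + graphex_norm1 G"
    by (rule nn_integral_marginal_base_update[OF mG M(1)])
  also have "\<dots> \<le> (\<integral>\<^sup>+x. marginal ?G x \<partial>M) + (graphex_norm1 ?G + ?\<eta>)"
    by (intro add_left_mono norm)
  finally have "graphex_norm1 ?G + (\<integral>\<^sup>+x. marginal G x \<partial>base G)
      \<le> graphex_norm1 ?G + ((\<integral>\<^sup>+x. marginal ?G x \<partial>M) + ?\<eta>)"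
    by (simp only: ac_simps)
  moreover have "graphex_norm1 ?G \<noteq> \<infinity>" using graphex_norm1_finite[OF mG' M(2)] by auto
  ultimately have int: "(\<integral>\<^sup>+x. marginal G x \<partial>base G) \<le> (\<integral>\<^sup>+x. marginal ?G x \<partial>M) + ?\<eta>"
    unfolding ennreal_add_left_cancel_le by simp
  let ?c = "space M - B"
  have split: "(\<integral>\<^sup>+x. f x \<partial>Q) = (\<integral>\<^sup>+x. f x * indicator B x \<partial>Q) + (\<integral>\<^sup>+x. f x * indicator ?c x \<partial>Q)"
    if [measurable]: "f \<in> borel_measurable Q" and "sets Q = sets M" for f Q
  proof -
    have [measurable]: "B \<in> sets Q" "?c \<in> sets Q" using BM that by simp_all
    have "space Q = space M" by (rule sets_eq_imp_space_eq) fact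
    then show ?thesis
      by (subst nn_integral_add[symmetric])
        (auto intro!: nn_integral_cong split: split_indicator)
  qed
  \<comment> \<open>Off \<open>B\<close> shrinking can only decrease the integral of the marginal,
    so the total bound \<open>?\<eta>\<close> also bounds the loss on \<open>B\<close> alone.
    Finiteness of the integral off \<open>B\<close> justifies the cancellation.\<close>
  have c_le: "(\<integral>\<^sup>+x. marginal ?G x * indicator ?c x \<partial>M) \<le> (\<integral>\<^sup>+x. marginal G x * indicator ?c x \<partial>base G)"
  proof -
    have "(\<integral>\<^sup>+x. marginal ?G x * indicator ?c x \<partial>M) \<le> (\<integral>\<^sup>+x. marginal G x * indicator ?c x \<partial>M)"
      by (intro nn_integral_mono mult_right_mono marginal_base_update_le[OF mG M(1)])
        (auto simp: space_M)
    also have "\<dots> \<le> (\<integral>\<^sup>+x. marginal G x * indicator ?c x \<partial>base G)"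
      by (intro nn_integral_measure_within_le[OF M(1) sf]) measurable
    finally show ?thesis .
  qed
  have "(\<integral>\<^sup>+x. marginal G x * indicator ?c x \<partial>base G) \<le> (\<integral>\<^sup>+x. marginal G x \<partial>base G)"
    by (intro nn_integral_mono) (auto simp: indicator_def)
  also have "\<dots> \<le> graphex_norm1 G" by (rule nn_integral_marginal_le_norm1[OF mG])
  finally have c_fin: "(\<integral>\<^sup>+x. marginal G x * indicator ?c x \<partial>base G) \<noteq> \<infinity>"
    using fin by auto
  have "(\<integral>\<^sup>+x. marginal G x * indicator ?c x \<partial>base G) + (\<integral>\<^sup>+x. marginal G x * indicator B x \<partial>base G)
      \<le> (\<integral>\<^sup>+x. marginal ?G x * indicator ?c x \<partial>M) + ((\<integral>\<^sup>+x. marginal ?G x * indicator B x \<partial>M) + ?\<eta>)"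
    using int unfolding split[OF m sets_M[symmetric]] split[OF m' refl] by (simp only: ac_simps)
  also have "\<dots> \<le> (\<integral>\<^sup>+x. marginal G x * indicator ?c x \<partial>base G)
      + ((\<integral>\<^sup>+x. marginal ?G x * indicator B x \<partial>M) + ?\<eta>)"
    by (intro add_right_mono c_le)
  finally have "(\<integral>\<^sup>+x. marginal G x * indicator B x \<partial>base G)
      \<le> (\<integral>\<^sup>+x. marginal ?G x * indicator B x \<partial>M) + ?\<eta>"
    using c_fin unfolding ennreal_add_left_cancel_le by simp
  also have "(\<integral>\<^sup>+x. marginal ?G x * indicator B x \<partial>M)
      \<le> ennreal (e ^ 4) + (1 + ennreal L) * emeasure M B + tail_integral N (marginal ?H) L"
    using nn_integral_marginal_set_le_of_delta22[OF mG' M(2) mH' N(2) d _ \<open>0 \<le> L\<close>, of B] BM by simp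
  also have "tail_integral N (marginal ?H) L \<le> tail_integral (base H) (marginal H) L"
    by (rule tail_integral_base_update_le[OF mH N(1)])
  also have "emeasure M B \<le> ennreal (1 / K) * graphex_norm1 G"
  proof -
    have "emeasure M B \<le> emeasure (base G) B" using M(1) B by (simp add: measure_within_def)
    also have "\<dots> \<le> emeasure (base G) {x \<in> space (base G). 1 \<le> ennreal (1 / K) * marginal G x}"
    proof (intro emeasure_mono subsetI)
      fix x assume "x \<in> B"
      then have x: "x \<in> space (base G)" "ennreal K \<le> marginal G x" by (auto simp: B_def)
      have "1 = ennreal (1 / K) * ennreal K" using \<open>0 < K\<close> by (simp flip: ennreal_mult)
      also have "\<dots> \<le> ennreal (1 / K) * marginal G x" by (intro mult_left_mono x) simp
      finally show "x \<in> {x \<in> space (base G). 1 \<le> ennreal (1 / K) * marginal G x}" using x by simp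
    qed measurable
    also have "\<dots> \<le> ennreal (1 / K) * (\<integral>\<^sup>+x. marginal G x * indicator (space (base G)) x \<partial>base G)"
      by (intro nn_integral_Markov_inequality) auto
    also have "(\<integral>\<^sup>+x. marginal G x * indicator (space (base G)) x \<partial>base G) = (\<integral>\<^sup>+x. marginal G x \<partial>base G)"
      by (intro nn_integral_cong) simp
    also have "\<dots> \<le> graphex_norm1 G" by (rule nn_integral_marginal_le_norm1[OF mG])
    finally show ?thesis by (simp add: mult_left_mono)
  qed
  finally have "(\<integral>\<^sup>+x. marginal G x * indicator B x \<partial>base G)
      \<le> ennreal (e ^ 4) + (1 + ennreal L) * (ennreal (1 / K) * graphex_norm1 G)
      + tail_integral (base H) (marginal H) L + ?\<eta>"
    by (simp add: add_left_mono add_right_mono mult_left_mono)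
  moreover have "tail_integral (base G) (marginal G) K = (\<integral>\<^sup>+x. marginal G x * indicator B x \<partial>base G)"
    unfolding tail_integral_def by (intro nn_integral_cong) (simp add: B_def indicator_def)
  ultimately show ?thesis by simp
qed

end

section \<open>Convergence of the norms\<close>

lemma le_liminf_of_eventually_le_add:
  fixes X :: "nat \<Rightarrow> ennreal"
  assumes "\<And>y::real. 0 < y \<Longrightarrow> \<forall>\<^sub>F n in sequentially. a \<le> X n + ennreal y"
  shows "a \<le> liminf X"
proof (rule ennreal_le_epsilon)
  fix y :: real assume "0 < y"
  from assms[OF this] have "\<forall>\<^sub>F n in sequentially. a - ennreal y \<le> X n"
    by eventually_elim (simp add: ennreal_minus_le_iff add.commute)
  then have "a - ennreal y \<le> liminf X" by (rule Liminf_bounded)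
  then show "a \<le> liminf X + ennreal y" by (simp add: ennreal_minus_le_iff add.commute)
qed

lemma limsup_le_of_eventually_le_add:
  fixes X :: "nat \<Rightarrow> ennreal"
  assumes "\<And>y::real. 0 < y \<Longrightarrow> \<forall>\<^sub>F n in sequentially. X n \<le> a + ennreal y"
  shows "limsup X \<le> a"
  by (rule ennreal_le_epsilon, rule Limsup_bounded, rule assms)

text \<open>With \<open>e\<close> at most 1 every power of \<open>e\<close> is at most
  \<open>e\<close>, so an error polynomial in \<open>e\<close> reduces to a linear one with
  coefficient \<open>c\<close>.\<close>

lemma obtain_small_factor:
  fixes c y :: real
  assumes "0 \<le> c" "0 < y"
  obtains e where "0 < e" "e \<le> 1" "e * c \<le> y"
proof
  show "0 < min 1 (y / (1 + c))" "min 1 (y / (1 + c)) \<le> 1" using assms by auto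
  have "min 1 (y / (1 + c)) * c \<le> y / (1 + c) * c" using assms by (intro mult_right_mono) auto
  also have "\<dots> \<le> y" using assms by (simp add: field_simps)
  finally show "min 1 (y / (1 + c)) * c \<le> y" .
qed

theorem theorem2p26:
  fixes G :: "nat \<Rightarrow> 'a graphex" and H :: "'b graphex"
  assumes "\<And>n. is_graphex (G n)"
    and "is_graphex H"
    and "\<And>n. graphex_integrable (G n)"
    and "(SUP n. graphex_norm1 (G n)) < \<infinity>"
    and "(\<lambda>n. weak_kernel_dist (G n) H) \<longlonglongrightarrow> 0"
  shows "graphex_norm1 H \<le> liminf (\<lambda>n. graphex_norm1 (G n)) \<and>
    graphex_integrable H \<and>
    ((\<lambda>n. graphex_norm1 (G n)) \<longlonglongrightarrow> graphex_norm1 H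
      \<longleftrightarrow> graphex_uniformly_integrable (range G))"
proof -
  note G = assms(1) and H = assms(2) and mG = is_graphex_measurable[OF assms(1)]
    and mH = is_graphex_measurable[OF assms(2)]
  let ?X = "\<lambda>n. graphex_norm1 (G n)" and ?D = "\<lambda>n. marginal (G n)"
  have fin: "?X n < \<infinity>" for n using assms(3) by (simp add: graphex_integrable_def)
  have close: "\<forall>\<^sub>F n in sequentially. weak_kernel_dist (G n) H < ennreal e" if "0 < e" for e
    using assms(5) that by (intro order_tendstoD) auto
  have e_pow: "e ^ k \<le> e" if "0 < e" "e \<le> 1" "0 < k" for e :: real and k
    using power_decreasing[of 1 k e] that by simp

  have liminf: "graphex_norm1 H \<le> liminf ?X"
  proof -
    let ?f = "\<lambda>x. (\<integral>\<^sup>+y. ennreal (kern H x y) \<partial>base H) + 2 * ennreal (star H x)"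
    \<comment> \<open>\<open>k\<close> and \<open>A\<close> stay fixed while \<open>n\<close> tends
      to infinity, so the error vanishes before the cut is removed.\<close>
    have trunc: "(\<integral>\<^sup>+x. min (?f x) (of_nat k) * indicator A x \<partial>base H) + 2 * ennreal (isol H) \<le> liminf ?X"
      (is "?T \<le> _") if A: "A \<in> sets (base H)" "emeasure (base H) A < \<infinity>" for k A
    proof (rule le_liminf_of_eventually_le_add)
      fix y :: real assume "0 < y"
      define m where "m = real k + measure (base H) A"
      have m: "of_nat k + emeasure (base H) A = ennreal m" "0 \<le> m"
        using A by (auto simp: m_def emeasure_eq_ennreal_measure ennreal_of_nat_eq_real_of_nat)
      obtain e where e: "0 < e" "e \<le> 1" "e * (1 + m) \<le> y"
        using obtain_small_factor[of "1 + m" y] m \<open>0 < y\<close> by auto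
      have "ennreal (e ^ 3) + ennreal (e\<^sup>2) * (of_nat k + emeasure (base H) A) = ennreal (e ^ 3 + e\<^sup>2 * m)"
        using e m by (simp add: ennreal_mult)
      also have "\<dots> \<le> ennreal y"
      proof (rule ennreal_leI)
        have "e ^ 3 + e\<^sup>2 * m \<le> e + e * m"
          using e m by (intro add_mono mult_right_mono e_pow) auto
        then show "e ^ 3 + e\<^sup>2 * m \<le> y" using e by (simp add: distrib_left)
      qed
      finally have small: "ennreal (e ^ 3) + ennreal (e\<^sup>2) * (of_nat k + emeasure (base H) A) \<le> ennreal y" .
      show "\<forall>\<^sub>F n in sequentially. ?T \<le> ?X n + ennreal y"
        using close[OF e(1)]
      proof eventually_elim
        case (elim n)
        from graphex_norm1_truncation_le_of_dist[OF G H elim A(1), of k]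
        have "?T \<le> ?X n + (ennreal (e ^ 3) + ennreal (e\<^sup>2) * (of_nat k + emeasure (base H) A))"
          by (simp only: add.assoc)
        also have "\<dots> \<le> ?X n + ennreal y" by (intro add_left_mono small)
        finally show ?case .
      qed
    qed
    \<comment> \<open>The empty set isolates the constant term; this makes its subtraction from the
      lower limit in \<open>ennreal\<close> reversible.\<close>
    have isol: "2 * ennreal (isol H) \<le> liminf ?X"
      using trunc[of "{}" 0] by simp
    have f [measurable]: "?f \<in> borel_measurable (base H)"
      using borel_measurable_degree[OF mH] borel_measurable_star[OF mH] by measurable
    have "(\<integral>\<^sup>+x. ?f x \<partial>base H) \<le> liminf ?X - 2 * ennreal (isol H)"
    proof (rule nn_integral_le_truncations[OF _ f])
      show "sigma_finite_measure (base H)" by (rule sigma_finite_base[OF mH])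
      fix k :: nat and A assume "A \<in> sets (base H)" "emeasure (base H) A < \<infinity>"
      from trunc[OF this, of k] isol
      show "(\<integral>\<^sup>+x. min (?f x) (of_nat k) * indicator A x \<partial>base H) \<le> liminf ?X - 2 * ennreal (isol H)"
        by (subst ennreal_le_minus_iff) (auto simp: add.commute ennreal_mult_eq_top_iff)
    qed
    then have "(\<integral>\<^sup>+x. ?f x \<partial>base H) + 2 * ennreal (isol H)
        \<le> liminf ?X - 2 * ennreal (isol H) + 2 * ennreal (isol H)"
      by (rule add_right_mono)
    also have "\<dots> = liminf ?X" using isol by (rule diff_add_cancel_ennreal)
    finally show ?thesis
      using borel_measurable_degree[OF mH] borel_measurable_star[OF mH]
      by (simp add: graphex_norm1_iterated[OF mH] nn_integral_add nn_integral_cmult)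
  qed

  have "liminf ?X \<le> (SUP n. ?X n)"
    by (rule order_trans[OF Liminf_le_Limsup Limsup_bounded]) (auto intro!: always_eventually SUP_upper)
  with liminf assms(4) have finH: "graphex_norm1 H < \<infinity>" by (meson order_le_less_trans)

  have lim: "?X \<longlonglongrightarrow> graphex_norm1 H" if ui: "graphex_uniformly_integrable (range G)"
  proof -
    have "limsup ?X \<le> graphex_norm1 H"
    proof (rule limsup_le_of_eventually_le_add)
      fix y :: real assume "0 < y"
      \<comment> \<open>The tail is counted twice and so uses \<open>y / 2\<close>, leaving
        \<open>y / 2\<close> for the terms in \<open>e\<close>.\<close>
      then have "0 < y / 4" by simp
      then obtain D where D: "\<And>n. tail_integral (base (G n)) (?D n) D < ennreal (y / 4)"
        using ui unfolding graphex_uniformly_integrable_def tail_integral_def by blast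
      \<comment> \<open>The level \<open>D\<close> may be negative, while the deficit bound needs a
        nonnegative one.\<close>
      define K where "K = max D 0"
      have K: "0 \<le> K" "tail_integral (base (G n)) (?D n) K \<le> ennreal (y / 4)" for n
        using order_trans[OF tail_integral_antimono less_imp_le[OF D[of n]], of K] by (auto simp: K_def)
      obtain e where e: "0 < e" "e \<le> 1" "e * (1 + 2 * K) \<le> y / 2"
        using obtain_small_factor[of "1 + 2 * K" "y / 2"] K(1) \<open>0 < y\<close> by auto
      have "ennreal (e ^ 3) + 2 * (ennreal (y / 4) + ennreal K * ennreal (e\<^sup>2))
          = ennreal (e ^ 3 + 2 * (y / 4 + K * e\<^sup>2))"
        using e(1) K(1) \<open>0 < y\<close>
        by (simp flip: ennreal_mult ennreal_plus ennreal_numeral)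
      also have "\<dots> \<le> ennreal y"
      proof (rule ennreal_leI)
        have "e ^ 3 + K * e\<^sup>2 * 2 \<le> e + K * e * 2"
          using e K(1) by (intro add_mono mult_right_mono mult_left_mono e_pow) auto
        then show "e ^ 3 + 2 * (y / 4 + K * e\<^sup>2) \<le> y" using e(3) by (simp add: algebra_simps)
      qed
      finally have small: "ennreal (e ^ 3) + 2 * (ennreal (y / 4) + ennreal K * ennreal (e\<^sup>2)) \<le> ennreal y" .
      show "\<forall>\<^sub>F n in sequentially. ?X n \<le> graphex_norm1 H + ennreal y"
        using close[OF e(1)]
      proof eventually_elim
        case (elim n)
        have "?X n \<le> graphex_norm1 H + ennreal (e ^ 3)
            + 2 * (tail_integral (base (G n)) (?D n) K + ennreal K * ennreal (e\<^sup>2))"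
          by (rule graphex_norm1_le_of_dist[OF G H elim K(1)])
        also have "\<dots> \<le> graphex_norm1 H + ennreal (e ^ 3)
            + 2 * (ennreal (y / 4) + ennreal K * ennreal (e\<^sup>2))"
          by (intro add_left_mono mult_left_mono add_right_mono K) auto
        also have "\<dots> \<le> graphex_norm1 H + ennreal y"
          unfolding add.assoc by (intro add_left_mono small)
        finally show ?case .
      qed
    qed
    then show ?thesis
      using liminf Liminf_le_Limsup[of sequentially ?X]
      by (intro Liminf_eq_Limsup) auto
  qed

  have ui: "graphex_uniformly_integrable (range G)" if lim: "?X \<longlonglongrightarrow> graphex_norm1 H"
  proof -
    obtain C where C: "0 \<le> C" "(SUP n. ?X n) = ennreal C"
      using assms(4) by (cases "SUP n. ?X n") auto
    have XC: "?X n \<le> ennreal C" for n unfolding C(2)[symmetric] by (rule SUP_upper) simp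
    have "\<exists>K. \<forall>n. tail_integral (base (G n)) (?D n) K < ennreal \<epsilon>" if "0 < \<epsilon>" for \<epsilon> :: real
    proof -
      have "(\<integral>\<^sup>+x. marginal H x \<partial>base H) < \<infinity>"
        using nn_integral_marginal_le_norm1[OF mH] finH by (rule order_le_less_trans)
      \<comment> \<open>The tail of \<open>H\<close> occurs once in the bound on \<open>B\<close>
        and twice in the loss, so \<open>\<epsilon> / 12\<close> adds up to
        \<open>\<epsilon> / 4\<close>. The Markov term, the excess of the norm and the terms in
        \<open>e\<close> get \<open>\<epsilon> / 8\<close> each, for a total of
        \<open>5 * \<epsilon> / 8\<close>.\<close>
      then obtain L where L: "0 \<le> L" "tail_integral (base H) (marginal H) L < ennreal (\<epsilon> / 12)"
        using tail_integral_less[OF borel_measurable_marginal[OF mH], of "ennreal (\<epsilon> / 12)"] \<open>0 < \<epsilon>\<close> by auto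
      \<comment> \<open>Chosen so that the Markov term \<open>(1 + L) * C / K\<close> is at most
        \<open>\<epsilon> / 8\<close>; \<open>1 + C\<close> instead of \<open>C\<close> keeps the
        level positive when \<open>C\<close> is 0.\<close>
      define K\<^sub>0 where "K\<^sub>0 = 8 * (1 + L) * (1 + C) / \<epsilon>"
      have K\<^sub>0: "0 < K\<^sub>0" using L C \<open>0 < \<epsilon>\<close> by (simp add: K\<^sub>0_def)
      have "(1 + L) * C \<le> (1 + L) * (1 + C)" using L C by (intro mult_left_mono) auto
      also have "\<dots> = \<epsilon> / 8 * K\<^sub>0" using \<open>0 < \<epsilon>\<close> by (simp add: K\<^sub>0_def)
      finally have K\<^sub>0C: "(1 + L) * (1 / K\<^sub>0 * C) \<le> \<epsilon> / 8"
        using K\<^sub>0 by (simp add: pos_divide_le_eq)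
      obtain e where e: "0 < e" "e \<le> 1" "e * (2 + 2 * L) \<le> \<epsilon> / 8"
        using obtain_small_factor[of "2 + 2 * L" "\<epsilon> / 8"] L(1) \<open>0 < \<epsilon>\<close> by auto
      have small: "ennreal (e ^ 4) + (1 + ennreal L) * (ennreal (1 / K\<^sub>0) * ennreal C) + ennreal (\<epsilon> / 12)
          + (ennreal (\<epsilon> / 8) + ennreal (e ^ 3) + 2 * (ennreal (\<epsilon> / 12) + ennreal L * ennreal (e\<^sup>2)))
          < ennreal \<epsilon>" (is "?s < _")
      proof -
        have "?s = ennreal (e ^ 4 + (1 + L) * (1 / K\<^sub>0 * C) + \<epsilon> / 12
            + (\<epsilon> / 8 + e ^ 3 + 2 * (\<epsilon> / 12 + L * e\<^sup>2)))"
          using e(1) L(1) C(1) K\<^sub>0 \<open>0 < \<epsilon>\<close>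
          by (simp flip: ennreal_mult ennreal_plus ennreal_numeral ennreal_1)
        also have "\<dots> < ennreal \<epsilon>"
        proof (rule ennreal_lessI[OF \<open>0 < \<epsilon>\<close>])
          have arith: "a + z + \<epsilon> / 12 + (\<epsilon> / 8 + b + 2 * (\<epsilon> / 12 + d)) < \<epsilon>"
            if "a + b + d * 2 \<le> \<epsilon> / 8" "z \<le> \<epsilon> / 8" for a b d z
            using that \<open>0 < \<epsilon>\<close> by simp
          have "e ^ 4 + e ^ 3 + L * e\<^sup>2 * 2 \<le> e + e + L * e * 2"
            using e L(1) by (intro add_mono mult_right_mono mult_left_mono e_pow) auto
          also have "\<dots> \<le> \<epsilon> / 8" using e(3) by (simp add: algebra_simps)
          finally show "e ^ 4 + (1 + L) * (1 / K\<^sub>0 * C) + \<epsilon> / 12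
              + (\<epsilon> / 8 + e ^ 3 + 2 * (\<epsilon> / 12 + L * e\<^sup>2)) < \<epsilon>"
            using K\<^sub>0C by (rule arith)
        qed
        finally show ?thesis .
      qed
      \<comment> \<open>Supplies the excess \<open>\<delta> = \<epsilon> / 8\<close>; the inequality
        is strict because \<open>H\<close> has finite norm.\<close>
      have "graphex_norm1 H < graphex_norm1 H + ennreal (\<epsilon> / 8)"
        using finH \<open>0 < \<epsilon>\<close> by (cases "graphex_norm1 H") (auto simp: ennreal_less_iff simp flip: ennreal_plus)
      from order_tendstoD(2)[OF lim this] close[OF e(1)]
      have "\<forall>\<^sub>F n in sequentially. tail_integral (base (G n)) (?D n) K\<^sub>0 < ennreal \<epsilon>"
      proof eventually_elim
        case (elim n)
        let ?tH = "tail_integral (base H) (marginal H) L"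
        have "tail_integral (base (G n)) (?D n) K\<^sub>0
            \<le> ennreal (e ^ 4) + (1 + ennreal L) * (ennreal (1 / K\<^sub>0) * ?X n) + ?tH
            + (ennreal (\<epsilon> / 8) + ennreal (e ^ 3) + 2 * (?tH + ennreal L * ennreal (e\<^sup>2)))"
          using elim by (intro tail_integral_marginal_le_of_dist G H fin K\<^sub>0 L) auto
        also have "\<dots> \<le> ennreal (e ^ 4) + (1 + ennreal L) * (ennreal (1 / K\<^sub>0) * ennreal C) + ennreal (\<epsilon> / 12)
            + (ennreal (\<epsilon> / 8) + ennreal (e ^ 3) + 2 * (ennreal (\<epsilon> / 12) + ennreal L * ennreal (e\<^sup>2)))"
          by (intro add_mono mult_left_mono XC order_refl less_imp_le[OF L(2)]) auto
        finally show ?case using small by (rule order_le_less_trans)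
      qed
      then obtain n\<^sub>0 where n\<^sub>0: "\<And>n. n\<^sub>0 \<le> n \<Longrightarrow> tail_integral (base (G n)) (?D n) K\<^sub>0 < ennreal \<epsilon>"
        by (auto simp: eventually_sequentially)
      \<comment> \<open>The finitely many graphexes before \<open>n\<^sub>0\<close> are integrable,
        so each has a level of its own.\<close>
      have "\<exists>K. 0 \<le> K \<and> tail_integral (base (G n)) (?D n) K < ennreal \<epsilon>" for n
      proof -
        have "(\<integral>\<^sup>+x. ?D n x \<partial>base (G n)) < \<infinity>"
          using nn_integral_marginal_le_norm1[OF mG] fin by (rule order_le_less_trans)
        from tail_integral_less[OF borel_measurable_marginal[OF mG] this, of "ennreal \<epsilon>"] \<open>0 < \<epsilon>\<close>
        show ?thesis by auto
      qed
      then obtain K where K: "\<And>n. 0 \<le> K n" "\<And>n. tail_integral (base (G n)) (?D n) (K n) < ennreal \<epsilon>"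
        by metis
      \<comment> \<open>Adding nonnegative levels gives one above them all, and raising the level
        only lowers a tail.\<close>
      have sum: "0 \<le> (\<Sum>n<n\<^sub>0. K n)" by (intro sum_nonneg K)
      have "tail_integral (base (G n)) (?D n) (K\<^sub>0 + (\<Sum>n<n\<^sub>0. K n)) < ennreal \<epsilon>" for n
      proof (cases "n < n\<^sub>0")
        case True
        then have "K n \<le> (\<Sum>n<n\<^sub>0. K n)" using K(1) by (intro member_le_sum) auto
        then have "K n \<le> K\<^sub>0 + (\<Sum>n<n\<^sub>0. K n)" using K\<^sub>0 by simp
        from order_le_less_trans[OF tail_integral_antimono[OF this] K(2)] show ?thesis .
      next
        case False
        have "K\<^sub>0 \<le> K\<^sub>0 + (\<Sum>n<n\<^sub>0. K n)" using sum by simp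
        from order_le_less_trans[OF tail_integral_antimono[OF this] n\<^sub>0] False show ?thesis by simp
      qed
      then show ?thesis by blast
    qed
    then show ?thesis
      unfolding graphex_uniformly_integrable_def tail_integral_def
      using assms(4) by (auto simp: image_comp)
  qed

  show ?thesis
    using liminf finH lim ui by (auto simp: graphex_integrable_def)
qed

end
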